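(* Let $a_1,a_2,b_1,b_2>0$ and $\lambda_1,\lambda_2\ge 0$, and let $G_1\sim\Gamma(a_1,b_1,\lambda_1)$ and $G_2\sim\Gamma(a_2,b_2,\lambda_2)$ be independent noncentral gamma random variables. Let $p_+$ be the density of $S:=G_1+G_2$. Then the following assertions hold. (i) If $\lambda_1=\lambda_2=0$, then $p_+$ is log-convex on $(0,\infty)$ if and only if $a_1+a_2\le 1$. (ii) If $a_1\ge 1$ and $a_2\ge 1$, then $p_+$ is log-concave on $(0,\infty)$. (iii) If $b_1=b_2$, then $p_+$ is log-concave on $(0,\infty)$ if and only if $a_1+a_2\ge 1$, and $p_+$ is log-convex on $(0,\infty)$ if and only if $\lambda_1=\lambda_2=0$ and $a_1+a_2\le 1$. (iv) Suppose $\lambda_1=\lambda_2=0$ and $a_1=a_2=:a$. If $b_1\ne b_2$, then $p_+$ is log-concave on $(0,\infty)$ if and only if $a\ge 1$.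
   Context: For $a,b>0$ and $\lambda\ge 0$, the noncentral gamma distribution $\Gamma(a,b,\lambda)$ is the distribution on $(0,\infty)$ with characteristic function $\mathsf{E}[e^{itG}]=(1-ibt)^{-a}\exp\left(\frac{ibt\lambda}{1-ibt}\right)$, $t\in\mathbb{R}$. Equivalently, it has density $$f_{a,b,\lambda}(x)=e^{-\lambda}\sum_{k=0}^{\infty}\frac{\lambda^k}{k!}\,\frac{x^{a+k-1}e^{-x/b}}{b^{a+k}\Gamma(a+k)},\qquad x>0,$$ with the convention $0^0=1$, so that $f_{a,b,0}(x)=\frac{x^{a-1}e^{-x/b}}{b^a\Gamma(a)}$. The density of $S=G_1+G_2$ is the (continuous) version on $(0,\infty)$ given by $p_+(x)=\int_0^x f_{a_1,b_1,\lambda_1}(x-y)\,f_{a_2,b_2,\lambda_2}(y)\,dy$, $x>0$. A positive function $h:I\to(0,\infty)$ on an interval $I\subseteq\mathbb{R}$ is log-convex on $I$ if $h(tx+(1-t)y)\le h(x)^t h(y)^{1-t}$ for all $x,y\in I$, $t\in[0,1]$, and log-concave on $I$ if the reverse inequality holds for all such $x,y,t$. *)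

theory Defs
  imports "HOL-Probability.Probability"
begin

definition log_convex_on :: "real set \<Rightarrow> (real \<Rightarrow> real) \<Rightarrow> bool" where
  "log_convex_on I h \<longleftrightarrow> is_interval I \<and> (\<forall>x\<in>I. 0 < h x) \<and>
     (\<forall>x\<in>I. \<forall>y\<in>I. \<forall>t\<in>{0..1}. h (t * x + (1 - t) * y) \<le> h x powr t * h y powr (1 - t))"

definition log_concave_on :: "real set \<Rightarrow> (real \<Rightarrow> real) \<Rightarrow> bool" where
  "log_concave_on I h \<longleftrightarrow> is_interval I \<and> (\<forall>x\<in>I. 0 < h x) \<and>
     (\<forall>x\<in>I. \<forall>y\<in>I. \<forall>t\<in>{0..1}. h (t * x + (1 - t) * y) \<ge> h x powr t * h y powr (1 - t))"

(* b is a scale parameter and l the noncentrality (Poisson) parameter; the term l ^ k uses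
   0 ^ 0 = 1, so that l = 0 gives the ordinary gamma density. *)
definition noncentral_gamma_density :: "real \<Rightarrow> real \<Rightarrow> real \<Rightarrow> real \<Rightarrow> real" where
  "noncentral_gamma_density a b l x =
     (if 0 < x
      then exp (- l) * (\<Sum>k. l ^ k / fact k *
             (x powr (a + real k - 1) * exp (- x / b) / (b powr (a + real k) * Gamma (a + real k))))
      else 0)"

definition noncentral_gamma_sum_density ::
    "real \<Rightarrow> real \<Rightarrow> real \<Rightarrow> real \<Rightarrow> real \<Rightarrow> real \<Rightarrow> real \<Rightarrow> real" where
  "noncentral_gamma_sum_density a1 b1 l1 a2 b2 l2 x =
     (LBINT y:{0<..<x}. noncentral_gamma_density a1 b1 l1 (x - y) *
                        noncentral_gamma_density a2 b2 l2 y)"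

lemma noncentral_gamma_density_central:
  "0 < x \<Longrightarrow> noncentral_gamma_density a b 0 x = x powr (a - 1) * exp (- x / b) / (b powr a * Gamma a)"
proof -
  assume x: "0 < x"
  have "(\<Sum>k. 0 ^ k / fact k *
             (x powr (a + real k - 1) * exp (- x / b) / (b powr (a + real k) * Gamma (a + real k))))
      = (\<Sum>k\<in>{0}. 0 ^ k / fact k *
             (x powr (a + real k - 1) * exp (- x / b) / (b powr (a + real k) * Gamma (a + real k))))"
    by (rule suminf_finite) auto
  with x show ?thesis by (simp add: noncentral_gamma_density_def)
qed

lemma borel_measurable_noncentral_gamma_density [measurable]:
  "noncentral_gamma_density a b l \<in> borel_measurable borel"
  unfolding noncentral_gamma_density_def[abs_def] by measurable

lemma summable_noncentral_gamma_density:
  fixes a b l x :: real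
  assumes "0 < a" "0 < b" "0 \<le> l" "0 < x"
  shows "summable (\<lambda>k. l ^ k / fact k *
             (x powr (a + real k - 1) * exp (- x / b) / (b powr (a + real k) * Gamma (a + real k))))"
proof -
  define g where "g = (\<lambda>k::nat. l ^ k / fact k *
             (x powr (a + real k - 1) * exp (- x / b) / (b powr (a + real k) * Gamma (a + real k))))"
  have pos: "0 \<le> g k" for k
    using assms by (auto simp: g_def intro!: mult_nonneg_nonneg divide_nonneg_nonneg Gamma_real_nonneg)
  have step: "g (Suc k) = l * x / b / (real (Suc k) * (a + real k)) * g k" for k
  proof -
    have "Gamma (a + real (Suc k)) = (a + real k) * Gamma (a + real k)"
      using Gamma_plus1[of "a + real k"] assms by (auto simp: add_ac nonpos_Ints_def)
    moreover have "x powr (a + real (Suc k) - 1) = x * x powr (a + real k - 1)"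
      using assms powr_add[of x 1 "a + real k - 1"] by (simp add: algebra_simps)
    moreover have "b powr (a + real (Suc k)) = b * b powr (a + real k)"
      using assms powr_add[of b 1 "a + real k"] by (simp add: algebra_simps)
    ultimately show ?thesis by (simp add: g_def field_simps)
  qed
  obtain N :: nat where N: "real N \<ge> 2 * (l * x / b) / a" using real_arch_simple by blast
  have "norm (g (Suc k)) \<le> 1/2 * norm (g k)" if "k \<ge> N" for k
  proof -
    have "2 * (l * x / b) \<le> real N * a" using N assms by (simp add: field_simps)
    also have "\<dots> \<le> real (Suc k) * (a + real k)"
      using that assms by (intro mult_mono) auto
    finally have "l * x / b / (real (Suc k) * (a + real k)) \<le> 1/2"
      using assms by (simp add: divide_le_eq mult_ac)
    with step pos show ?thesis by (metis mult_right_mono abs_of_nonneg real_norm_def)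
  qed
  then have "summable g" by (intro summable_ratio_test[where c = "1/2" and N = N]) auto
  then show ?thesis by (simp add: g_def)
qed

lemma noncentral_gamma_density_nonneg:
  assumes "0 < a" "0 < b" "0 \<le> l"
  shows "0 \<le> noncentral_gamma_density a b l x"
  using summable_noncentral_gamma_density[OF assms, of x] assms
  by (auto simp: noncentral_gamma_density_def
           intro!: mult_nonneg_nonneg suminf_nonneg divide_nonneg_nonneg Gamma_real_nonneg)

lemma nn_integral_noncentral_gamma_density:
  assumes ab: "0 < a" "0 < b" "0 \<le> l"
  shows "(\<integral>\<^sup>+ x. ennreal (noncentral_gamma_density a b l x) \<partial>lborel) = 1"
proof -
  define w where "w = (\<lambda>k::nat. exp (- l) * (l ^ k / fact k))"
  define g where "g = (\<lambda>(k::nat) x. indicator {0<..} x *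
    (x powr (a + real k - 1) * exp (- x / b) / (b powr (a + real k) * Gamma (a + real k))))"
  have w: "0 \<le> w k" for k using ab by (simp add: w_def)
  have gnn: "0 \<le> g k x" for k x
    using ab by (auto simp: g_def indicator_def intro!: divide_nonneg_nonneg Gamma_real_nonneg)
  have [measurable]: "g k \<in> borel_measurable borel" for k unfolding g_def by measurable
  have Gint: "(\<integral>\<^sup>+ x. ennreal (g k x) \<partial>lborel) = 1" for k
  proof -
    define s where "s = a + real k"
    have s: "0 < s" "0 < Gamma s" using ab by (auto simp: s_def intro!: Gamma_real_pos)
    have "(\<integral>\<^sup>+ x. ennreal (indicator {0<..} x * (x powr (s - 1) / exp x)) \<partial>lborel) = ennreal (Gamma s)"
    proof (rule nn_integral_has_integral_lborel)
      have "((\<lambda>t. if t \<in> {0..} then t powr (s - 1) / exp t else 0) has_integral Gamma s) UNIV"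
        using Gamma_integral_real[OF s(1)] by (simp only: has_integral_restrict_UNIV)
      then show "((\<lambda>x. indicator {0<..} x * (x powr (s - 1) / exp x)) has_integral Gamma s) UNIV"
        by (rule has_integral_spike[where S = "{0}", rotated 2]) (auto simp: indicator_def)
    qed (auto simp: indicator_def)
    then have "ennreal (Gamma s) =
        ennreal (1 / b) * (\<integral>\<^sup>+ x. ennreal (indicator {0<..} (x / b) * ((x / b) powr (s - 1) / exp (x / b))) \<partial>lborel)"
      using ab by (subst (asm) nn_integral_real_affine[where c = "1 / b" and t = 0]) auto
    also have "\<dots> = (\<integral>\<^sup>+ x. ennreal (Gamma s) * ennreal (g k x) \<partial>lborel)"
    proof (subst nn_integral_cmult[symmetric])
      show "(\<integral>\<^sup>+ x. ennreal (1 / b) * ennreal (indicator {0<..} (x / b) * ((x / b) powr (s - 1) / exp (x / b))) \<partial>lborel)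
        = (\<integral>\<^sup>+ x. ennreal (Gamma s) * ennreal (g k x) \<partial>lborel)"
      proof (intro nn_integral_cong)
        fix x :: real
        have "1 / b * (indicator {0<..} (x / b) * ((x / b) powr (s - 1) / exp (x / b))) = Gamma s * g k x"
        proof (cases "0 < x")
          case True
          have "b powr s = b * b powr (s - 1)"
            using ab powr_add[of b 1 "s - 1"] by simp
          have cancel: "c * (u / (v * c)) = u / v" if "0 < c" for c u v :: real
            using that by simp
          have "Gamma s * g k x = x powr (s - 1) * exp (- x / b) / b powr s"
            using True cancel[OF s(2)] by (simp add: g_def flip: s_def)
          then show ?thesis
            using True ab \<open>b powr s = _\<close> by (simp add: powr_divide exp_minus field_simps)
        qed (use ab in \<open>auto simp: g_def indicator_def zero_less_divide_iff\<close>)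
        then show "ennreal (1 / b) * ennreal (indicator {0<..} (x / b) * ((x / b) powr (s - 1) / exp (x / b)))
            = ennreal (Gamma s) * ennreal (g k x)"
          using ab s gnn by (simp add: ennreal_mult[symmetric] flip: ennreal_mult'')
      qed
    qed measurable
    also have "\<dots> = ennreal (Gamma s) * (\<integral>\<^sup>+ x. ennreal (g k x) \<partial>lborel)"
      by (rule nn_integral_cmult) measurable
    finally have "ennreal (Gamma s) * (\<integral>\<^sup>+ x. ennreal (g k x) \<partial>lborel) = ennreal (Gamma s) * 1" by simp
    then show ?thesis using s by (subst (asm) ennreal_mult_cancel_left) auto
  qed
  have "ennreal (noncentral_gamma_density a b l x) = (\<Sum>k. ennreal (w k) * ennreal (g k x))" for x
  proof (cases "0 < x")
    case True
    note sm = summable_noncentral_gamma_density[OF ab True]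
    have "noncentral_gamma_density a b l x = (\<Sum>k. w k * g k x)"
      using True suminf_mult[OF sm, of "exp (- l)"]
      by (simp add: noncentral_gamma_density_def w_def g_def mult.assoc)
    moreover have "summable (\<lambda>k. w k * g k x)"
      using True summable_mult[OF sm, of "exp (- l)"] by (simp add: w_def g_def mult.assoc)
    ultimately show ?thesis
      using w gnn by (simp add: ennreal_mult[symmetric] suminf_ennreal2)
  qed (simp add: noncentral_gamma_density_def g_def)
  then have "(\<integral>\<^sup>+ x. ennreal (noncentral_gamma_density a b l x) \<partial>lborel)
      = (\<Sum>k. ennreal (w k) * (\<integral>\<^sup>+ x. ennreal (g k x) \<partial>lborel))"
    by (simp add: nn_integral_suminf nn_integral_cmult)
  also have "\<dots> = (\<Sum>k. ennreal (w k))" by (simp add: Gint)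
  also have "\<dots> = 1"
  proof -
    have "(\<lambda>k. w k) sums (exp (- l) * exp l)"
      unfolding w_def using sums_mult[OF exp_converges[of l], of "exp (- l)"]
      by (simp add: scaleR_conv_of_real divide_inverse mult_ac)
    then have "w sums 1" by (simp add: exp_minus)
    then show ?thesis using w by (metis suminf_ennreal2 ennreal_1 sums_iff)
  qed
  finally show ?thesis .
qed

lemma (in prob_space) noncentral_gamma_sum_distributed:
  assumes "0 < a1" "0 < b1" "0 \<le> l1" "0 < a2" "0 < b2" "0 \<le> l2"
    and D1: "distributed M lborel G1 (\<lambda>x. ennreal (noncentral_gamma_density a1 b1 l1 x))"
    and D2: "distributed M lborel G2 (\<lambda>x. ennreal (noncentral_gamma_density a2 b2 l2 x))"
    and ind: "indep_var borel G1 borel G2"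
  shows "distributed M lborel (\<lambda>\<omega>. G1 \<omega> + G2 \<omega>)
           (\<lambda>x. ennreal (noncentral_gamma_sum_density a1 b1 l1 a2 b2 l2 x))"
proof -
  let ?f = "noncentral_gamma_density a1 b1 l1" and ?g = "noncentral_gamma_density a2 b2 l2"
  let ?h = "\<lambda>x. \<integral>\<^sup>+ y. ennreal (?f (x - y)) * ennreal (?g y) \<partial>lborel"
  let ?p = "noncentral_gamma_sum_density a1 b1 l1 a2 b2 l2"
  note nn = noncentral_gamma_density_nonneg[OF assms(1-3)] noncentral_gamma_density_nonneg[OF assms(4-6)]
  have *: "distributed M lborel (\<lambda>\<omega>. G1 \<omega> + G2 \<omega>) ?h"
    using distributed_convolution[OF ind D1 D2] .
  have [measurable]: "?h \<in> borel_measurable lborel" using * by (simp add: distributed_def)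
  have fin: "AE x in lborel. ?h x \<noteq> \<infinity>"
  proof (rule nn_integral_PInf_AE)
    interpret S: prob_space "distr M lborel (\<lambda>\<omega>. G1 \<omega> + G2 \<omega>)"
      using * by (intro prob_space_distr) (simp add: distributed_def)
    have "emeasure (density lborel ?h) UNIV = 1"
      using S.emeasure_space_1 distributed_distr_eq_density[OF *] by simp
    then show "(\<integral>\<^sup>+ x. ?h x \<partial>lborel) \<noteq> \<infinity>" by (simp add: emeasure_density)
  qed simp
  have eq: "?p x = enn2real (?h x)" for x
  proof -
    have "?p x = (LBINT y. ?f (x - y) * ?g y)"
      unfolding noncentral_gamma_sum_density_def set_lebesgue_integral_def
      by (intro Bochner_Integration.integral_cong)
         (auto simp: indicator_def noncentral_gamma_density_def)
    also have "\<dots> = enn2real (\<integral>\<^sup>+ y. ennreal (?f (x - y) * ?g y) \<partial>lborel)"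
      by (rule integral_eq_nn_integral) (auto simp: nn)
    also have "\<dots> = enn2real (?h x)" by (simp add: ennreal_mult nn)
    finally show ?thesis .
  qed
  have [measurable]: "?p \<in> borel_measurable lborel"
    unfolding eq[abs_def] by measurable
  have "AE x in lborel. ?h x = ennreal (?p x)"
    using fin by eventually_elim (simp add: eq top.not_eq_extremum)
  then have "density lborel ?h = density lborel (\<lambda>x. ennreal (?p x))"
    by (intro density_cong) auto
  with * show ?thesis by (auto simp: distributed_def)
qed

end

theory Submission
  imports Defs "HOL-Real_Asymp.Real_Asymp"
begin

text \<open>
  The density factors as \<open>x powr (a - 1) * exp (- x / b) * H (l * x / b)\<close> up to a constant, where
  \<open>H z = (\<Sum>k. z ^ k / (k! \<Gamma>(a + k)))\<close> is log-concave for every \<open>a > 0\<close>; so the density is log-concave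
  for \<open>a \<ge> 1\<close>, and log-concavity passes to the convolution by Prekopa's theorem on the line. For
  equal scales the convolution is again a noncentral gamma density, with shape \<open>a1 + a2\<close>. For
  central summands and \<open>a1 + a2 \<le> 1\<close> the density is a mixture over \<open>u \<in> (0, 1)\<close> of the log-convex
  functions \<open>x powr (a1 + a2 - 1) * exp (- q u * x)\<close>. All failures are visible in the asymptotics:
  at the origin the density of the sum behaves like \<open>x powr (a1 + a2 - 1)\<close>; at infinity, after
  removal of the slowest exponential, it behaves like \<open>x powr (a - 1)\<close> in the situation of (iv), and
  it is unbounded but subexponential if \<open>b1 = b2\<close> and \<open>l1 + l2 > 0\<close>.
\<close>

text \<open>The behaviour at the origin excludes log-concavity only for \<open>a1 + a2 < 1\<close>,
  so in (iv) the range \<open>1 / 2 \<le> a < 1\<close> has to be settled at infinity. Unequal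
  scales matter there: the summand with the smaller scale contributes only an integrable kernel, and
  the exponent \<open>a - 1\<close> of the other one survives instead of \<open>2 * a - 1\<close>.

  In the Prekopa step the superlevel sets of the two given functions enter only through their infima
  and suprema, because those of the third function are intervals; Brunn-Minkowski on the line thus
  becomes a comparison of lengths. Normalising suprema presupposes bounded sections, and
  log-concavity itself supplies the bound.

  Passing to reciprocals lets a single decay estimate for log-concave functions serve both the
  failure of log-concavity in (iv) and the failure of log-convexity in (iii).\<close>

section \<open>Log-concavity as concavity of the logarithm\<close>

lemma concave_on_real_iff:
  fixes f :: "real \<Rightarrow> real"
  shows "concave_on I f \<longleftrightarrow> convex I \<and>
    (\<forall>x\<in>I. \<forall>y\<in>I. \<forall>t\<in>{0..1}. t * f x + (1 - t) * f y \<le> f (t * x + (1 - t) * y))"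
proof -
  have "(\<forall>u\<ge>0. \<forall>v\<ge>0. u + v = 1 \<longrightarrow> P u v) \<longleftrightarrow> (\<forall>t\<in>{0..1}. P t (1 - t))" for P :: "real \<Rightarrow> real \<Rightarrow> bool"
  proof safe
    fix u v :: real assume "\<forall>t\<in>{0..1}. P t (1 - t)" "0 \<le> u" "0 \<le> v" "u + v = 1"
    moreover from this have "v = 1 - u" by simp
    ultimately show "P u v" by simp
  qed auto
  then show ?thesis unfolding concave_on_iff by simp
qed

lemma log_concave_on_iff_ln:
  "log_concave_on I h \<longleftrightarrow> (\<forall>x\<in>I. 0 < h x) \<and> concave_on I (\<lambda>x. ln (h x))"
proof (cases "(\<forall>x\<in>I. 0 < h x) \<and> convex I")
  case True
  have "(h x powr t * h y powr (1 - t) \<le> h (t * x + (1 - t) * y))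
      = (t * ln (h x) + (1 - t) * ln (h y) \<le> ln (h (t * x + (1 - t) * y)))"
    if "x \<in> I" "y \<in> I" "t \<in> {0..1}" for x y t
  proof -
    have "t * x + (1 - t) * y \<in> I"
      using True that convexD[of I x y t "1 - t"] by simp
    then have "0 < h (t * x + (1 - t) * y)" using True by blast
    moreover have "h x \<noteq> 0" "h y \<noteq> 0" using True that by force+
    then have "h x powr t * h y powr (1 - t) = exp (t * ln (h x) + (1 - t) * ln (h y))"
      by (simp add: powr_def exp_add)
    ultimately show ?thesis by (metis exp_le_cancel_iff exp_ln)
  qed
  then show ?thesis using True
    by (simp add: log_concave_on_def concave_on_real_iff is_interval_convex_1)
qed (auto simp: log_concave_on_def is_interval_convex_1 dest: concave_on_imp_convex)

lemma log_concave_on_lnD: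
  assumes "log_concave_on I h" "x \<in> I" "y \<in> I" "t \<in> {0..1}"
  shows "t * ln (h x) + (1 - t) * ln (h y) \<le> ln (h (t * x + (1 - t) * y))"
  using assms by (simp add: log_concave_on_iff_ln concave_on_real_iff)

lemma log_concave_on_cong:
  assumes "\<And>x. x \<in> I \<Longrightarrow> g x = h x"
  shows "log_concave_on I g \<longleftrightarrow> log_concave_on I h"
proof -
  have "t * x + (1 - t) * y \<in> I" if "is_interval I" "x \<in> I" "y \<in> I" "t \<in> {0..1}" for x y t
    using that convexD[of I x y t "1 - t"] by (simp add: is_interval_convex_1)
  with assms show ?thesis by (fastforce simp: log_concave_on_def)
qed

lemma log_convex_on_cong:
  assumes "\<And>x. x \<in> I \<Longrightarrow> g x = h x"
  shows "log_convex_on I g \<longleftrightarrow> log_convex_on I h"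
proof -
  have "t * x + (1 - t) * y \<in> I" if "is_interval I" "x \<in> I" "y \<in> I" "t \<in> {0..1}" for x y t
    using that convexD[of I x y t "1 - t"] by (simp add: is_interval_convex_1)
  with assms show ?thesis by (fastforce simp: log_convex_on_def)
qed

lemma log_concave_on_mult:
  assumes "log_concave_on I f" "log_concave_on I g"
  shows "log_concave_on I (\<lambda>x. f x * g x)"
  unfolding log_concave_on_def
proof (intro conjI ballI)
  fix x y t assume xy: "x \<in> I" "y \<in> I" and t: "t \<in> {0..1::real}"
  have nn: "0 \<le> f x" "0 \<le> f y" "0 \<le> g x" "0 \<le> g y"
    using assms xy by (auto simp: log_concave_on_def less_imp_le)
  have "(f x * g x) powr t * (f y * g y) powr (1 - t)
      = (f x powr t * f y powr (1 - t)) * (g x powr t * g y powr (1 - t))"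
    using nn by (simp add: powr_mult)
  also have "\<dots> \<le> f (t * x + (1 - t) * y) * g (t * x + (1 - t) * y)"
    using assms xy t by (intro mult_mono') (auto simp: log_concave_on_def)
  finally show "(f x * g x) powr t * (f y * g y) powr (1 - t)
      \<le> f (t * x + (1 - t) * y) * g (t * x + (1 - t) * y)" .
qed (use assms in \<open>auto simp: log_concave_on_def\<close>)

section \<open>Convolution of log-concave functions\<close>

text \<open>Only lengths enter: \<open>A\<close> and \<open>B\<close> lie between their infima and
  suprema, and the interval \<open>C\<close> contains every point strictly between the combined
  infima and the combined suprema.\<close>

lemma emeasure_interval_combination:
  fixes A B C :: "real set"
  assumes A: "bounded A" "A \<noteq> {}" and B: "bounded B" "B \<noteq> {}"
    and C: "is_interval C" "C \<in> sets borel" and t: "0 < t" "t < 1"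
    and sub: "\<And>u v. u \<in> A \<Longrightarrow> v \<in> B \<Longrightarrow> t * u + (1 - t) * v \<in> C"
  shows "ennreal t * emeasure lborel A + ennreal (1 - t) * emeasure lborel B \<le> emeasure lborel C"
proof -
  note bdd = bounded_imp_bdd_above[OF A(1)] bounded_imp_bdd_below[OF A(1)]
    bounded_imp_bdd_above[OF B(1)] bounded_imp_bdd_below[OF B(1)]
  have len: "emeasure lborel S \<le> ennreal (Sup S - Inf S)" "0 \<le> Sup S - Inf S"
    if S: "bounded S" "S \<noteq> {}" for S :: "real set"
  proof -
    note bS = bounded_imp_bdd_above[OF S(1)] bounded_imp_bdd_below[OF S(1)]
    have "emeasure lborel S \<le> emeasure lborel {Inf S..Sup S}"
      using bS by (intro emeasure_mono) (auto intro: cSup_upper cInf_lower)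
    moreover show *: "0 \<le> Sup S - Inf S" using S bS by (simp add: cInf_le_cSup)
    ultimately show "emeasure lborel S \<le> ennreal (Sup S - Inf S)" by simp
  qed
  define l where "l = t * Inf A + (1 - t) * Inf B"
  define r where "r = t * Sup A + (1 - t) * Sup B"
  have le: "l \<le> r" unfolding l_def r_def
    using len(2)[OF A] len(2)[OF B] t by (intro add_mono mult_left_mono) auto
  have "{l<..<r} \<subseteq> C"
  proof
    fix z assume z: "z \<in> {l<..<r}"
    \<comment> \<open>The distances of \<open>z\<close> to the two ends serve as slack: near-infima
      of \<open>A\<close> and \<open>B\<close>, each within \<open>d\<close>, combine to a point of
      \<open>C\<close> below \<open>z\<close>, and near-suprema within \<open>e\<close> to one
      above. The weights sum to one, so the combined slack is again \<open>d\<close> or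
      \<open>e\<close>.\<close>
    define d where "d = (z - l)"
    define e where "e = (r - z)"
    obtain u where u: "u \<in> A" "u < Inf A + d"
      using cInf_lessD[OF A(2), of "Inf A + d"] z by (auto simp: d_def)
    obtain v where v: "v \<in> B" "v < Inf B + d"
      using cInf_lessD[OF B(2), of "Inf B + d"] z by (auto simp: d_def)
    obtain u' where u': "u' \<in> A" "Sup A - e < u'"
      using less_cSupD[OF A(2), of "Sup A - e"] z by (auto simp: e_def)
    obtain v' where v': "v' \<in> B" "Sup B - e < v'"
      using less_cSupD[OF B(2), of "Sup B - e"] z by (auto simp: e_def)
    have "t * u + (1 - t) * v < t * (Inf A + d) + (1 - t) * (Inf B + d)"
      using u v t by (intro add_strict_mono mult_strict_left_mono) auto
    also have "\<dots> = z" by (simp add: d_def l_def algebra_simps)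
    finally have 1: "t * u + (1 - t) * v \<le> z" by simp
    have "z = t * (Sup A - e) + (1 - t) * (Sup B - e)" by (simp add: e_def r_def algebra_simps)
    also have "\<dots> < t * u' + (1 - t) * v'"
      using u' v' t by (intro add_strict_mono mult_strict_left_mono) auto
    finally have 2: "z \<le> t * u' + (1 - t) * v'" by simp
    show "z \<in> C" using C(1) sub[OF u(1) v(1)] sub[OF u'(1) v'(1)] 1 2
      by (meson is_interval_1)
  qed
  then have "emeasure lborel {l<..<r} \<le> emeasure lborel C" using C by (intro emeasure_mono) auto
  then have "ennreal (r - l) \<le> emeasure lborel C" using le by simp
  moreover have "ennreal t * emeasure lborel A + ennreal (1 - t) * emeasure lborel B
     \<le> ennreal t * ennreal (Sup A - Inf A) + ennreal (1 - t) * ennreal (Sup B - Inf B)"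
    using len[OF A] len[OF B] by (intro add_mono mult_left_mono) auto
  moreover have "\<dots> = ennreal (r - l)"
  proof -
    have "r - l = t * (Sup A - Inf A) + (1 - t) * (Sup B - Inf B)"
      by (simp add: l_def r_def algebra_simps)
    then show ?thesis
      using len(2)[OF A] len(2)[OF B] t by (simp add: ennreal_mult ennreal_plus)
  qed
  ultimately show ?thesis by simp
qed

text \<open>Negative values of \<open>f\<close> disappear on both sides: \<open>ennreal\<close>
  truncates them, and only positive levels are integrated.\<close>

lemma nn_integral_layer_cake:
  fixes f :: "real \<Rightarrow> real"
  assumes [measurable]: "f \<in> borel_measurable borel"
  shows "(\<integral>\<^sup>+ y. ennreal (f y) \<partial>lborel)
    = (\<integral>\<^sup>+ s. indicator {0<..} s * emeasure lborel {y. s < f y} \<partial>lborel)"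
proof -
  have "(\<integral>\<^sup>+ y. ennreal (f y) \<partial>lborel)
      = (\<integral>\<^sup>+ y. (\<integral>\<^sup>+ s. indicator {0<..} s * indicator {s. s < f y} s \<partial>lborel) \<partial>lborel)"
  proof (rule nn_integral_cong)
    fix y
    have "(\<integral>\<^sup>+ s. indicator {0<..} s * indicator {s. s < f y} s \<partial>lborel)
      = (\<integral>\<^sup>+ s. indicator {0<..<f y} s \<partial>lborel)"
      by (intro nn_integral_cong) (auto simp: indicator_def)
    also have "\<dots> = ennreal (f y)"
      by (cases "0 \<le> f y") (auto simp: ennreal_neg)
    finally show "ennreal (f y) = (\<integral>\<^sup>+ s. indicator {0<..} s * indicator {s. s < f y} s \<partial>lborel)" by simp
  qed
  also have "\<dots> = (\<integral>\<^sup>+ s. (\<integral>\<^sup>+ y. indicator {0<..} s * indicator {s. s < f y} s \<partial>lborel) \<partial>lborel)"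
    by (rule lborel_pair.Fubini') measurable
  also have "\<dots> = (\<integral>\<^sup>+ s. indicator {0<..} s * emeasure lborel {y. s < f y} \<partial>lborel)"
  proof (rule nn_integral_cong)
    fix s :: real
    have "(\<integral>\<^sup>+ y. indicator {0<..} s * indicator {s. s < f y} s \<partial>lborel)
      = (\<integral>\<^sup>+ y. indicator {0<..} s * indicator {y. s < f y} y \<partial>lborel)"
      by (intro nn_integral_cong) (auto simp: indicator_def)
    then show "(\<integral>\<^sup>+ y. indicator {0<..} s * indicator {s. s < f y} s \<partial>lborel)
      = indicator {0<..} s * emeasure lborel {y. s < f y}"
      by (simp add: nn_integral_cmult)
  qed
  finally show ?thesis .
qed

text \<open>After normalising the suprema of \<open>f\<close> and \<open>g\<close> to 1, all superlevel sets for levels below 1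
  are non-empty, and the layer cake formula reduces the claim to intervals.\<close>

lemma prekopa_leindler_unimodal:
  fixes f g h :: "real \<Rightarrow> real"
  assumes t: "0 < t" "t < 1"
    and int: "integrable lborel f" "integrable lborel g" "integrable lborel h"
    and mble [measurable]: "f \<in> borel_measurable borel" "g \<in> borel_measurable borel" "h \<in> borel_measurable borel"
    and nn: "\<And>y. 0 \<le> f y" "\<And>y. 0 \<le> g y" "\<And>y. 0 \<le> h y"
    and bdd: "bdd_above (range f)" "bdd_above (range g)"
    and pos: "0 < f y1" "0 < g y2" "0 < (LBINT y. f y)" "0 < (LBINT y. g y)"
    and supp: "bounded {y. 0 < f y}" "bounded {y. 0 < g y}"
    and lev: "\<And>s. 0 < s \<Longrightarrow> is_interval {y. s < h y}"
    and le: "\<And>u v. 0 < f u \<Longrightarrow> 0 < g v \<Longrightarrow> f u powr t * g v powr (1 - t) \<le> h (t * u + (1 - t) * v)"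
  shows "(LBINT y. f y) powr t * (LBINT y. g y) powr (1 - t) \<le> (LBINT y. h y)"
proof -
  define F where "F = (SUP y. f y)"
  define G where "G = (SUP y. g y)"
  have F: "0 < F" "f y \<le> F" and G: "0 < G" "g y \<le> G" for y
    using bdd pos by (auto simp: F_def G_def intro: cSUP_upper less_le_trans)
  \<comment> \<open>Chosen so that the levels \<open>s * F\<close> of \<open>f\<close> and
    \<open>s * G\<close> of \<open>g\<close> combine exactly to the level \<open>s * H\<close> of
    \<open>h\<close>.\<close>
  define H where "H = F powr t * G powr (1 - t)"
  have H: "0 < H" using F(1) G(1) by (simp add: H_def)
  let ?f = "\<lambda>y. f y / F" and ?g = "\<lambda>y. g y / G" and ?h = "\<lambda>y. h y / H"
  have nonempty: "\<exists>y. s < k y / (SUP y. k y)" if k: "0 < (SUP y. k y)" "bdd_above (range k)" "s < 1"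
    for k :: "real \<Rightarrow> real" and s
  proof -
    have "s * (SUP y. k y) < (SUP y. k y)" using k by simp
    then obtain y where "s * (SUP y. k y) < k y"
      using k(2) less_cSUP_iff[of UNIV k "s * (SUP y. k y)"] by blast
    then show ?thesis using k by (auto simp: field_simps)
  qed
  have combine: "ennreal t * emeasure lborel {y. s < ?f y} + ennreal (1 - t) * emeasure lborel {y. s < ?g y}
      \<le> emeasure lborel {y. s < ?h y}" if s: "0 < s" "s < 1" for s
  proof (rule emeasure_interval_combination)
    have "{y. s < ?f y} \<subseteq> {y. 0 < f y}" "{y. s < ?g y} \<subseteq> {y. 0 < g y}"
      using s F(1) G(1) by (auto simp: zero_less_divide_iff dest!: less_trans[OF s(1)])
    then show "bounded {y. s < ?f y}" "bounded {y. s < ?g y}"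
      using supp by (auto intro: bounded_subset)
    show "{y. s < ?f y} \<noteq> {}" "{y. s < ?g y} \<noteq> {}"
      using nonempty[of f s] nonempty[of g s] F(1) G(1) bdd s by (auto simp: F_def G_def)
    have "{y. s < ?h y} = {y. s * H < h y}" using H by (auto simp: field_simps)
    then show "is_interval {y. s < ?h y}" using lev[of "s * H"] H s by simp
    show "t * u + (1 - t) * v \<in> {y. s < ?h y}" if "u \<in> {y. s < ?f y}" "v \<in> {y. s < ?g y}" for u v
    proof -
      from that s F(1) G(1) have *: "s * F < f u" "s * G < g v" by (auto simp: field_simps)
      then have fp: "0 < f u" "0 < g v" using s F(1) G(1) by (meson mult_pos_pos less_trans)+
      have "s * H = (s * F) powr t * (s * G) powr (1 - t)"
        using s F(1) G(1) powr_add[of s t "1 - t"] by (simp add: H_def powr_mult)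
      also have "\<dots> < f u powr t * g v powr (1 - t)"
        using * fp s F(1) G(1) t by (intro mult_strict_mono powr_less_mono2) (auto simp: less_imp_le)
      also have "\<dots> \<le> h (t * u + (1 - t) * v)" by (rule le[OF fp])
      finally show ?thesis using H by (simp add: field_simps)
    qed
  qed (use t in measurable)
  \<comment> \<open>From level 1 on the left-hand sets are empty, so the levelwise inequality is
    trivial there.\<close>
  have top: "emeasure lborel {y. s < ?f y} = 0" "emeasure lborel {y. s < ?g y} = 0" if "1 \<le> s" for s
  proof -
    have "?f y \<le> s" "?g y \<le> s" for y
      using F G that by (auto intro: order_trans[of _ 1])
    then have "{y. s < ?f y} = {}" "{y. s < ?g y} = {}" by (auto simp: not_less)
    then show "emeasure lborel {y. s < ?f y} = 0" "emeasure lborel {y. s < ?g y} = 0" by simp_all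
  qed
  have "ennreal t * (\<integral>\<^sup>+ y. ennreal (?f y) \<partial>lborel) + ennreal (1 - t) * (\<integral>\<^sup>+ y. ennreal (?g y) \<partial>lborel)
    = (\<integral>\<^sup>+ s. indicator {0<..} s * (ennreal t * emeasure lborel {y. s < ?f y}
        + ennreal (1 - t) * emeasure lborel {y. s < ?g y}) \<partial>lborel)"
    by (subst (1 2) nn_integral_layer_cake)
       (simp_all add: nn_integral_cmult[symmetric] nn_integral_add[symmetric] distrib_left mult_ac)
  also have "\<dots> \<le> (\<integral>\<^sup>+ s. indicator {0<..} s * emeasure lborel {y. s < ?h y} \<partial>lborel)"
  proof (rule nn_integral_mono)
    fix s :: real
    show "indicator {0<..} s * (ennreal t * emeasure lborel {y. s < ?f y}
        + ennreal (1 - t) * emeasure lborel {y. s < ?g y}) \<le> indicator {0<..} s * emeasure lborel {y. s < ?h y}"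
      using combine[of s] top[of s] by (cases "0 < s"; cases "s < 1") auto
  qed
  also have "\<dots> = (\<integral>\<^sup>+ y. ennreal (?h y) \<partial>lborel)" by (rule nn_integral_layer_cake[symmetric]) simp
  finally have "ennreal t * ennreal (LBINT y. ?f y) + ennreal (1 - t) * ennreal (LBINT y. ?g y)
      \<le> ennreal (LBINT y. ?h y)"
    using nn F(1) G(1) H int by (simp add: nn_integral_eq_integral)
  moreover have Inn: "0 \<le> (LBINT y. ?f y)" "0 \<le> (LBINT y. ?g y)" "0 \<le> (LBINT y. ?h y)"
    using nn F(1) G(1) H by (auto intro!: integral_nonneg_AE divide_nonneg_nonneg simp: less_imp_le)
  ultimately have "ennreal (t * (LBINT y. ?f y) + (1 - t) * (LBINT y. ?g y)) \<le> ennreal (LBINT y. ?h y)"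
    using t by (simp only: ennreal_plus ennreal_mult mult_nonneg_nonneg less_imp_le diff_ge_0_iff_ge)
  then have "t * (LBINT y. ?f y) + (1 - t) * (LBINT y. ?g y) \<le> (LBINT y. ?h y)"
    using Inn by (subst (asm) ennreal_le_iff) auto
  \<comment> \<open>The normalised integrals satisfy the stronger bound by the arithmetic mean;
    weighted AM-GM weakens it to the geometric mean, in which \<open>F\<close> and \<open>G\<close>
    cancel against \<open>H\<close>.\<close>
  moreover have "((LBINT y. f y) / F) powr t * ((LBINT y. g y) / G) powr (1 - t)
      \<le> t * ((LBINT y. f y) / F) + (1 - t) * ((LBINT y. g y) / G)"
    using t pos F(1) G(1) by (intro Youngs_inequality_0) auto
  ultimately have "((LBINT y. f y) / F) powr t * ((LBINT y. g y) / G) powr (1 - t) \<le> (LBINT y. h y) / H"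
    by simp
  then show ?thesis using F(1) G(1) H nn
    by (simp add: powr_divide integral_nonneg_AE H_def field_simps)
qed


text \<open>A concave function on the half-line may tend to minus infinity at 0 but not to plus
  infinity: the values at \<open>x\<close> and \<open>2 * x\<close> control everything to their
  left.\<close>

lemma log_concave_on_bdd_above:
  assumes f: "log_concave_on {0<..} f"
  shows "\<exists>K. \<forall>y\<in>{0<..<x}. f y \<le> K"
proof (intro exI ballI)
  fix y assume y: "y \<in> {0<..<x}"
  have pos: "0 < f y" "0 < f x" "0 < f (2 * x)" using f y by (auto simp: log_concave_on_def)
  \<comment> \<open>The weight that writes \<open>x\<close> as a combination of \<open>y\<close> and
    \<open>2 * x\<close>. It is at least 1/2, so dividing by it at most doubles the bound.\<close>
  define t where "t = x / (2 * x - y)"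
  have t: "t \<in> {0..1}" "1 / 2 \<le> t" and "t * (2 * x - y) = x"
    using y by (auto simp: t_def field_simps)
  then have eq: "t * y + (1 - t) * (2 * x) = x" by (simp add: algebra_simps)
  have "t * ln (f y) + (1 - t) * ln (f (2 * x)) \<le> ln (f x)"
    using log_concave_on_lnD[OF f, of y "2 * x" t] y t eq by simp
  moreover have "- \<bar>ln (f (2 * x))\<bar> \<le> (1 - t) * ln (f (2 * x))"
  proof -
    have "\<bar>(1 - t) * ln (f (2 * x))\<bar> \<le> 1 * \<bar>ln (f (2 * x))\<bar>"
      unfolding abs_mult using t by (intro mult_right_mono) auto
    then show ?thesis by linarith
  qed
  ultimately have *: "t * ln (f y) \<le> \<bar>ln (f x)\<bar> + \<bar>ln (f (2 * x))\<bar>" by linarith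
  have "ln (f y) \<le> 2 * (\<bar>ln (f x)\<bar> + \<bar>ln (f (2 * x))\<bar>)"
  proof (cases "0 \<le> ln (f y)")
    case True
    then have "1 / 2 * ln (f y) \<le> t * ln (f y)" using t by (intro mult_right_mono) auto
    from order_trans[OF this *] show ?thesis by simp
  next
    case False
    then have "ln (f y) \<le> 0" by simp
    also have "0 \<le> 2 * (\<bar>ln (f x)\<bar> + \<bar>ln (f (2 * x))\<bar>)" by simp
    finally show ?thesis .
  qed
  then show "f y \<le> exp (2 * (\<bar>ln (f x)\<bar> + \<bar>ln (f (2 * x))\<bar>))"
    using pos by (metis exp_le_cancel_iff exp_ln)
qed

text \<open>The integrand, restricted to \<open>0 < y < x\<close>, is jointly log-concave in \<open>(x, y)\<close>.\<close>

lemma log_concave_on_convolution: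
  assumes f: "log_concave_on {0<..} f" and g: "log_concave_on {0<..} g"
    and [measurable]: "f \<in> borel_measurable borel" "g \<in> borel_measurable borel"
    and pos: "\<And>x. 0 < x \<Longrightarrow> 0 < (LBINT y:{0<..<x}. f (x - y) * g y)"
  shows "log_concave_on {0<..} (\<lambda>x. LBINT y:{0<..<x}. f (x - y) * g y)"
  unfolding log_concave_on_def
proof (intro conjI ballI)
  define \<phi> where "\<phi> x y = indicator {0<..<x} y * (f (x - y) * g y)" for x y :: real
  have \<phi>_pos: "0 < \<phi> x y" if "0 < y" "y < x" for x y
    using f g that by (simp add: \<phi>_def log_concave_on_def)
  have \<phi>_zero: "\<phi> x y = 0" if "\<not> (0 < y \<and> y < x)" for x y
    using that by (simp add: \<phi>_def)
  have \<phi>_nn: "0 \<le> \<phi> x y" for x y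
    using \<phi>_pos[of y x] \<phi>_zero[of y x] by (cases "0 < y \<and> y < x") auto
  have [measurable]: "\<phi> x \<in> borel_measurable borel" for x
    unfolding \<phi>_def by measurable
  \<comment> \<open>Boundedness gives integrability over the bounded support and the finite suprema
    needed for the normalisation.\<close>
  have \<phi>_bdd: "\<exists>K. \<forall>y. \<phi> x y \<le> K" for x
  proof -
    obtain K L where K: "f y \<le> K" and L: "g y \<le> L" if "y \<in> {0<..<x}" for y
      using log_concave_on_bdd_above[OF f, of x] log_concave_on_bdd_above[OF g, of x] by blast
    have "\<phi> x y \<le> \<bar>K * L\<bar>" for y
    proof (cases "0 < y \<and> y < x")
      case True
      then have "\<phi> x y \<le> K * L"
        using K[of "x - y"] L[of y] f g
        by (auto simp: \<phi>_def log_concave_on_def less_imp_le intro!: mult_mono order_trans[OF _ K])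
      then show ?thesis by linarith
    qed (simp add: \<phi>_zero)
    then show ?thesis by blast
  qed
  have \<phi>_int: "integrable lborel (\<phi> x)" for x
  proof -
    obtain K where K: "\<And>y. \<phi> x y \<le> K" using \<phi>_bdd by blast
    show ?thesis
    proof (rule Bochner_Integration.integrable_bound)
      show "integrable lborel (\<lambda>y. K * indicator {0<..<x} y)"
        by (cases "0 < x") (auto intro!: integrable_mult_right integrable_real_indicator)
      show "AE y in lborel. norm (\<phi> x y) \<le> norm (K * indicator {0<..<x} y)"
        using K[THEN order_trans, OF abs_ge_self] \<phi>_nn \<phi>_zero by (auto simp: indicator_def)
    qed simp
  qed
  have conv: "(LBINT y:{0<..<x}. f (x - y) * g y) = (LBINT y. \<phi> x y)" for x :: real
    by (simp add: set_lebesgue_integral_def \<phi>_def)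
  have joint: "\<phi> x u powr t * \<phi> z v powr (1 - t) \<le> \<phi> (t * x + (1 - t) * z) (t * u + (1 - t) * v)"
    if u: "0 < \<phi> x u" and v: "0 < \<phi> z v" and t: "t \<in> {0..1}" for x z u v t
  proof -
    have u': "0 < u" "u < x" and v': "0 < v" "v < z"
      using u v \<phi>_zero by (metis less_irrefl)+
    have sum: "(1 - t) * p + t * q > 0" if "0 < p" "0 < q" for p q :: real
      using that t by (metis add_pos_nonneg add_nonneg_pos atLeastAtMost_iff diff_ge_0_iff_ge
          less_eq_real_def mult_nonneg_nonneg mult_pos_pos mult_zero_left add_0 diff_0_right
          diff_gt_0_iff_gt mult_1)
    have w: "0 < t * u + (1 - t) * v" "t * u + (1 - t) * v < t * x + (1 - t) * z"
      using sum[of v u] sum[of "z - v" "x - u"] u' v' by (auto simp: algebra_simps)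
    have pos: "0 < f (x - u)" "0 < f (z - v)" "0 < g u" "0 < g v"
      using f g u' v' by (auto simp: log_concave_on_def)
    have "\<phi> x u powr t * \<phi> z v powr (1 - t)
      = (f (x - u) powr t * f (z - v) powr (1 - t)) * (g u powr t * g v powr (1 - t))"
      using u' v' pos by (simp add: \<phi>_def powr_mult)
    also have "\<dots> \<le> f (t * (x - u) + (1 - t) * (z - v)) * g (t * u + (1 - t) * v)"
      using f g u' v' t by (intro mult_mono') (auto simp: log_concave_on_def)
    also have "\<dots> = \<phi> (t * x + (1 - t) * z) (t * u + (1 - t) * v)"
      using w by (simp add: \<phi>_def algebra_simps)
    finally show ?thesis .
  qed
  fix x z t :: real assume xz: "x \<in> {0<..}" "z \<in> {0<..}" and t: "t \<in> {0..1::real}"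
  consider "t = 0" | "t = 1" | "0 < t" "t < 1" using t by fastforce
  then show "(LBINT y:{0<..<x}. f (x - y) * g y) powr t * (LBINT y:{0<..<z}. f (z - y) * g y) powr (1 - t)
      \<le> (LBINT y:{0<..<t * x + (1 - t) * z}. f (t * x + (1 - t) * z - y) * g y)"
  proof cases
    case 3
    show ?thesis unfolding conv
    proof (rule prekopa_leindler_unimodal[OF 3, where ?y1.0 = "x / 2" and ?y2.0 = "z / 2"])
      show "0 < \<phi> x (x / 2)" "0 < \<phi> z (z / 2)" using xz by (auto intro!: \<phi>_pos)
      show "bdd_above (range (\<phi> x))" "bdd_above (range (\<phi> z))"
        using \<phi>_bdd by (auto simp: bdd_above_def)
      have "{y. 0 < \<phi> x y} \<subseteq> {0..x}" for x
        using \<phi>_zero by (auto simp: less_le) (metis linear not_le)+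
      then show "bounded {y. 0 < \<phi> x y}" "bounded {y. 0 < \<phi> z y}"
        using bounded_closed_interval bounded_subset by blast+
      fix s :: real assume s: "0 < s"
      \<comment> \<open>A section of a jointly log-concave function is log-concave, so its
        superlevel sets are intervals: \<open>joint\<close> is used with equal first
        arguments.\<close>
      show "is_interval {y. s < \<phi> (t * x + (1 - t) * z) y}" (is "is_interval {y. s < ?\<psi> y}")
        unfolding is_interval_convex_1 convex_alt
      proof safe
        fix u v r :: real
        assume uv: "s < ?\<psi> u" "s < ?\<psi> v" and r: "0 \<le> r" "r \<le> 1"
        define m where "m = min (?\<psi> u) (?\<psi> v)"
        have m: "s < m" "0 < m" "m \<le> ?\<psi> u" "m \<le> ?\<psi> v" using uv s by (auto simp: m_def)
        note m(1)
        also have "m = m powr (1 - r) * m powr r" using m by (simp flip: powr_add)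
        also have "\<dots> \<le> ?\<psi> u powr (1 - r) * ?\<psi> v powr r"
          using m r by (intro mult_mono powr_mono2) auto
        also have "\<dots> \<le> ?\<psi> ((1 - r) * u + r * v)"
        proof -
          have "(1 - r) * (t * x + (1 - t) * z) + (1 - (1 - r)) * (t * x + (1 - t) * z) = t * x + (1 - t) * z"
            by (simp add: algebra_simps)
          then show ?thesis
            using joint[of "t * x + (1 - t) * z" u "t * x + (1 - t) * z" v "1 - r"] uv s r
            by (simp add: less_trans[OF s])
        qed
        finally show "s < ?\<psi> ((1 - r) *\<^sub>R u + r *\<^sub>R v)" by simp
      qed
    qed (use joint t xz pos conv in \<open>auto simp: \<phi>_nn \<phi>_int\<close>)
  qed (use xz pos in \<open>auto simp: less_imp_le\<close>)
qed (auto simp: pos is_interval_convex_1)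

section \<open>Elementary log-concave functions\<close>

lemma log_concave_on_const: "0 < c \<Longrightarrow> log_concave_on {0<..} (\<lambda>x. c)"
  by (simp add: log_concave_on_iff_ln concave_on_const)

lemma log_concave_on_powr: "0 \<le> r \<Longrightarrow> log_concave_on {0<..} (\<lambda>x. x powr r)"
  using concave_on_cmul[OF _ ln_concave, of r] by (simp add: log_concave_on_iff_ln ln_powr)

lemma log_concave_on_exp: "log_concave_on {0<..} (\<lambda>x. exp (c * x))"
  by (simp add: log_concave_on_iff_ln concave_on_real_iff algebra_simps)

lemma log_concave_on_scale:
  assumes h: "log_concave_on {0<..} h" and c: "0 < c"
  shows "log_concave_on {0<..} (\<lambda>x. h (c * x))"
  unfolding log_concave_on_def
proof (intro conjI ballI)
  fix x y t :: real assume "x \<in> {0<..}" "y \<in> {0<..}" and t: "t \<in> {0..1}"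
  then have "h (c * x) powr t * h (c * y) powr (1 - t) \<le> h (t * (c * x) + (1 - t) * (c * y))"
    using h c by (auto simp: log_concave_on_def)
  then show "h (c * x) powr t * h (c * y) powr (1 - t) \<le> h (c * (t * x + (1 - t) * y))"
    by (simp add: algebra_simps)
qed (use h c in \<open>auto simp: log_concave_on_def\<close>)

section \<open>Noncentral gamma densities\<close>

text \<open>The hypergeometric function 0F1 with parameter \<open>a\<close>, divided by
  \<open>Gamma a\<close>; for \<open>z > 0\<close> it is \<open>z powr (- (a - 1) / 2)\<close> times
  the modified Bessel function of order \<open>a - 1\<close> at \<open>2 * sqrt z\<close>. In this
  normalisation differentiation just raises \<open>a\<close> by one.\<close>

definition gamma_series :: "real \<Rightarrow> real \<Rightarrow> real" where
  "gamma_series a z = (\<Sum>k. z ^ k / (fact k * Gamma (a + real k)))"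

lemma Gamma_plus_nat_Suc:
  fixes a :: real
  assumes "0 < a"
  shows "Gamma (a + 1 + real k) = (a + real k) * Gamma (a + real k)"
  using Gamma_plus1[of "a + real k"] assms by (simp add: add_ac nonpos_Ints_def)

lemma summable_gamma_series_abs:
  assumes "0 < a"
  shows "summable (\<lambda>k. \<bar>z ^ k / (fact k * Gamma (a + real k))\<bar>)"
proof -
  have "\<bar>Gamma (a + real k)\<bar> = Gamma (a + real k)" for k
    using assms Gamma_real_pos[of "a + real k"] by simp
  then show ?thesis
    \<comment> \<open>At scale 1 and argument 1 the density series has these terms up to the factor
      \<open>exp (- 1)\<close>, which \<open>exp 1\<close> undoes.\<close>
    using summable_mult[OF summable_noncentral_gamma_density[of a 1 "\<bar>z\<bar>" 1], of "exp 1"] assms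
    by (simp add: abs_mult power_abs exp_minus field_simps)
qed

lemma summable_gamma_series:
  assumes "0 < a"
  shows "summable (\<lambda>k. z ^ k / (fact k * Gamma (a + real k)))"
  using summable_gamma_series_abs[OF assms, of z] by (rule summable_rabs_cancel)

lemma gamma_series_term_nonneg:
  "0 < a \<Longrightarrow> 0 \<le> z \<Longrightarrow> 0 \<le> z ^ k / (fact k * Gamma (a + real k))"
  using Gamma_real_pos[of "a + real k"] by simp

lemma gamma_series_ge_term:
  assumes "0 < a" "0 \<le> z"
  shows "z ^ k / (fact k * Gamma (a + real k)) \<le> gamma_series a z"
  unfolding gamma_series_def
  using sum_le_suminf[OF summable_gamma_series[OF assms(1), of z], of "{k}"] gamma_series_term_nonneg[OF assms]
  by simp

lemma gamma_series_pos: "0 < a \<Longrightarrow> 0 \<le> z \<Longrightarrow> 0 < gamma_series a z"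
  using gamma_series_ge_term[of a z 0] Gamma_real_pos[of a] by (auto intro: less_le_trans[of 0 "1 / Gamma a"])

lemma gamma_series_mono:
  assumes "0 < a" "0 \<le> y" "y \<le> z"
  shows "gamma_series a y \<le> gamma_series a z"
  unfolding gamma_series_def
  using assms Gamma_real_pos[of "a + real _"]
  by (intro suminf_le summable_gamma_series divide_right_mono power_mono) (auto intro: less_imp_le)

lemma DERIV_gamma_series:
  assumes a: "0 < a"
  shows "(gamma_series a has_field_derivative gamma_series (a + 1) z) (at z)"
proof -
  define c where "c k = 1 / (fact k * Gamma (a + real k))" for k
  have "summable (\<lambda>k. c k * y ^ k)" for y
    using summable_gamma_series[OF a, of y] by (simp add: c_def)
  then have "((\<lambda>x. \<Sum>k. c k * x ^ k) has_field_derivative (\<Sum>k. diffs c k * z ^ k)) (at z)"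
    by (rule termdiffs_strong_converges_everywhere)
  moreover have "diffs c k = 1 / (fact k * Gamma (a + 1 + real k))" for k
  proof -
    have "c (Suc k) = 1 / (real (Suc k) * fact k * Gamma (a + 1 + real k))"
      by (simp add: c_def add_ac)
    then show ?thesis by (simp add: diffs_def del: of_nat_Suc)
  qed
  ultimately show ?thesis by (simp add: gamma_series_def[abs_def] c_def)
qed

text \<open>The factor \<open>k\<close> cancels against \<open>fact k\<close>; an index shift then
  turns this part into \<open>z\<close> times the series for \<open>a + 1\<close>. The remaining
  part is \<open>a\<close> times the series itself.\<close>

lemma gamma_series_mean:
  assumes a: "0 < a"
  shows "(\<lambda>k. (a + real k) * (z ^ k / (fact k * Gamma (a + real k)))) sums
    (z * gamma_series (a + 1) z + a * gamma_series a z)"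
proof -
  have "(\<lambda>k. z * (z ^ k / (fact k * Gamma (a + 1 + real k)))) sums (z * gamma_series (a + 1) z)"
    unfolding gamma_series_def using a by (intro sums_mult summable_sums summable_gamma_series) auto
  moreover have "z * (z ^ k / (fact k * Gamma (a + 1 + real k)))
      = real (Suc k) * (z ^ Suc k / (fact (Suc k) * Gamma (a + real (Suc k))))" for k
  proof -
    have eq: "a + real (Suc k) = a + 1 + real k" by simp
    show ?thesis unfolding eq by (simp del: of_nat_Suc)
  qed
  ultimately have "(\<lambda>k. real (Suc k) * (z ^ Suc k / (fact (Suc k) * Gamma (a + real (Suc k)))))
      sums (z * gamma_series (a + 1) z)" by (simp only:)
  then have "(\<lambda>k. real k * (z ^ k / (fact k * Gamma (a + real k)))) sums (z * gamma_series (a + 1) z)"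
    by (subst (asm) sums_Suc_iff) simp
  moreover have "(\<lambda>k. a * (z ^ k / (fact k * Gamma (a + real k)))) sums (a * gamma_series a z)"
    unfolding gamma_series_def using a by (intro sums_mult summable_sums summable_gamma_series) auto
  ultimately have "(\<lambda>k. a * (z ^ k / (fact k * Gamma (a + real k))) + real k * (z ^ k / (fact k * Gamma (a + real k))))
      sums (a * gamma_series a z + z * gamma_series (a + 1) z)" by (intro sums_add)
  then show ?thesis by (simp only: distrib_right add.commute[of "a * gamma_series a z"])
qed

text \<open>Evaluate the mean of \<open>a + 1 + k\<close> under the weights for \<open>a + 1\<close>
  in two ways: by \<open>gamma_series_mean\<close>, and by letting the summand \<open>a + k\<close>
  lower the Gamma function in the denominator.\<close>

lemma gamma_series_recurrence:
  assumes a: "0 < a"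
  shows "gamma_series a z = z * gamma_series (a + 2) z + a * gamma_series (a + 1) z"
proof -
  have "(a + 1 + real k) * (z ^ k / (fact k * Gamma (a + 1 + real k)))
      = z ^ k / (fact k * Gamma (a + real k)) + z ^ k / (fact k * Gamma (a + 1 + real k))" for k
  proof -
    have "(q + 1) * (u / (v * (q * w))) = u / (v * w) + u / (v * (q * w))" if "q \<noteq> 0" for q u v w :: real
      using that by (cases "v * w = 0") (auto simp: field_simps)
    from this[of "a + real k" "z ^ k" "fact k" "Gamma (a + real k)"] show ?thesis
      using a unfolding Gamma_plus_nat_Suc[OF a] by (simp add: add_ac)
  qed
  then have "(\<lambda>k. z ^ k / (fact k * Gamma (a + real k)) + z ^ k / (fact k * Gamma (a + 1 + real k)))
      sums (z * gamma_series (a + 2) z + (a + 1) * gamma_series (a + 1) z)"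
    using gamma_series_mean[of "a + 1" z] a by (simp add: add.assoc)
  moreover have "(\<lambda>k. z ^ k / (fact k * Gamma (a + real k)) + z ^ k / (fact k * Gamma (a + 1 + real k)))
      sums (gamma_series a z + gamma_series (a + 1) z)"
    unfolding gamma_series_def using a by (intro sums_add summable_sums summable_gamma_series) auto
  ultimately show ?thesis by (auto dest: sums_unique2 simp: algebra_simps)
qed

text \<open>For weights \<open>z ^ k / (k! \<Gamma>(a + k))\<close>, the mean of
  \<open>1 / (a + k)\<close> is at least the reciprocal of the mean of \<open>a + k\<close>; both means are expressible by
  contiguous series.\<close>

lemma gamma_series_turan:
  assumes a: "0 < a" and z: "0 < z"
  shows "gamma_series a z * gamma_series (a + 2) z \<le> (gamma_series (a + 1) z)\<^sup>2"
proof -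
  define p where "p k = z ^ k / (fact k * Gamma (a + real k))" for k
  define H0 where "H0 = gamma_series a z"
  define H1 where "H1 = gamma_series (a + 1) z"
  define H2 where "H2 = gamma_series (a + 2) z"
  have pos: "0 < H0" "0 < H1" using a z by (auto simp: H0_def H1_def intro: gamma_series_pos)
  have p: "0 \<le> p k" for k using gamma_series_term_nonneg[of a z k] a z by (simp add: p_def)
  define S where "S = z * H1 + a * H0"
  have S: "0 < S" using pos a z by (simp add: S_def add_pos_pos)
  define m where "m = S / H0"
  have m: "0 < m" using S pos by (simp add: m_def)
  have sum: "p sums H0" "(\<lambda>k. (a + real k) * p k) sums S"
    using gamma_series_mean[OF a, of z] summable_sums[OF summable_gamma_series[OF a, of z]]
    by (simp_all add: p_def[abs_def] S_def H1_def H0_def gamma_series_def)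
  have "p k / (a + real k) = z ^ k / (fact k * Gamma (a + 1 + real k))" for k
    unfolding Gamma_plus_nat_Suc[OF a] by (simp add: p_def)
  then have inv: "(\<lambda>k. p k / (a + real k)) sums H1"
    using summable_sums[OF summable_gamma_series[of "a + 1" z]] a by (simp add: H1_def gamma_series_def)
  \<comment> \<open>Jensen's inequality made explicit: the convex function \<open>1 / q\<close> lies
    above its tangent \<open>2 / m - q / m\<^sup>2\<close> at the mean \<open>m\<close>, and the
    tangent is summed against the weights.\<close>
  have "2 / m * H0 - 1 / m\<^sup>2 * S \<le> H1"
  proof (rule sums_le)
    show "(\<lambda>k. 2 / m * p k - 1 / m\<^sup>2 * ((a + real k) * p k)) sums (2 / m * H0 - 1 / m\<^sup>2 * S)"
      by (intro sums_diff sums_mult sum)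
    show "(\<lambda>k. p k / (a + real k)) sums H1" by (rule inv)
    fix k
    define q where "q = a + real k"
    have q: "0 < q" using a by (simp add: q_def)
    have "0 \<le> (m - q)\<^sup>2 / (m\<^sup>2 * q)" using q by simp
    also have "\<dots> = 1 / q - (2 / m - q / m\<^sup>2)"
      using m q by (simp add: field_simps power2_eq_square)
    finally have "(2 / m - q / m\<^sup>2) * p k \<le> 1 / q * p k"
      using p[of k] by (intro mult_right_mono) auto
    then show "2 / m * p k - 1 / m\<^sup>2 * ((a + real k) * p k) \<le> p k / (a + real k)"
      by (simp add: q_def[symmetric] algebra_simps)
  qed
  also have "2 / m * H0 - 1 / m\<^sup>2 * S = H0\<^sup>2 / S"
    using S pos by (simp add: m_def field_simps power2_eq_square)
  finally have "H0 * H0 \<le> H1 * S" using S by (simp add: divide_le_eq power2_eq_square)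
  moreover have "H0 = z * H2 + a * H1"
    using gamma_series_recurrence[OF a, of z] by (simp add: H0_def H1_def H2_def)
  \<comment> \<open>The term \<open>a * H0 * H1\<close> occurs on both sides and cancels.\<close>
  ultimately have "H0 * (z * H2 + a * H1) \<le> H1 * (z * H1 + a * H0)" by (simp add: S_def)
  then have "z * (H0 * H2) \<le> z * (H1 * H1)" by (simp add: algebra_simps)
  then show ?thesis using z by (simp add: H0_def H1_def H2_def power2_eq_square)
qed

lemma log_concave_on_gamma_series:
  assumes a: "0 < a"
  shows "log_concave_on {0<..} (gamma_series a)"
proof -
  have pos: "0 < gamma_series a x" if "0 < x" for x using a that by (intro gamma_series_pos) auto
  have "concave_on {0<..} (\<lambda>x. ln (gamma_series a x))"
  proof (rule f''_le0_imp_concave)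
    fix x :: real assume x: "x \<in> {0<..}"
    note [derivative_intros] = DERIV_gamma_series[THEN DERIV_chain2]
    show "((\<lambda>x. ln (gamma_series a x)) has_real_derivative gamma_series (a + 1) x / gamma_series a x) (at x)"
      using x pos[of x] a by (auto intro!: derivative_eq_intros)
    show "((\<lambda>x. gamma_series (a + 1) x / gamma_series a x) has_real_derivative
       (gamma_series (a + 2) x * gamma_series a x - gamma_series (a + 1) x * gamma_series (a + 1) x)
         / (gamma_series a x * gamma_series a x)) (at x)"
      using x pos[of x] a by (auto intro!: derivative_eq_intros simp: add.assoc)
    show "(gamma_series (a + 2) x * gamma_series a x - gamma_series (a + 1) x * gamma_series (a + 1) x)
         / (gamma_series a x * gamma_series a x) \<le> 0"
      using gamma_series_turan[OF a, of x] x pos[of x]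
      by (intro divide_nonpos_pos) (auto simp: power2_eq_square mult.commute)
  qed simp
  then show ?thesis using pos by (simp add: log_concave_on_iff_ln)
qed

section \<open>The densities and their two-sided power bounds\<close>

lemma noncentral_gamma_density_eq:
  assumes "0 < a" "0 < b" "0 < x"
  shows "noncentral_gamma_density a b l x
    = exp (- l) / b powr a * x powr (a - 1) * exp (- x / b) * gamma_series a (l * x / b)"
proof -
  have "l ^ k / fact k * (x powr (a + real k - 1) * exp (- x / b) / (b powr (a + real k) * Gamma (a + real k)))
    = x powr (a - 1) * exp (- x / b) / b powr a * ((l * x / b) ^ k / (fact k * Gamma (a + real k)))" for k
  proof -
    have "x powr (a + real k - 1) = x powr (a - 1) * x ^ k"
      using assms powr_add[of x "a - 1" "real k"] by (simp add: powr_realpow algebra_simps)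
    moreover have "b powr (a + real k) = b powr a * b ^ k"
      using assms by (simp add: powr_add powr_realpow)
    ultimately show ?thesis by (simp add: power_mult_distrib power_divide mult_ac)
  qed
  then show ?thesis
    using assms suminf_mult[OF summable_gamma_series[of a "l * x / b"], of "x powr (a - 1) * exp (- x / b) / b powr a"]
    by (simp add: noncentral_gamma_density_def gamma_series_def mult.assoc)
qed

lemma log_concave_on_noncentral_gamma_density:
  assumes "1 \<le> a" "0 < b" "0 \<le> l"
  shows "log_concave_on {0<..} (noncentral_gamma_density a b l)"
proof -
  have "log_concave_on {0<..} (\<lambda>x. gamma_series a (l * x / b))"
  \<comment> \<open>Rescaling needs a positive factor; for \<open>l = 0\<close> the series is
    constant.\<close>
  proof (cases "l = 0")
    case True
    then show ?thesis using assms by (simp add: log_concave_on_const gamma_series_pos)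
  next
    case False
    then show ?thesis
      using assms log_concave_on_scale[OF log_concave_on_gamma_series[of a], of "l / b"] by simp
  qed
  moreover have "log_concave_on {0<..} (\<lambda>x. exp (- x / b))"
    using log_concave_on_exp[of "- 1 / b"] by simp
  ultimately have "log_concave_on {0<..}
     (\<lambda>x. exp (- l) / b powr a * x powr (a - 1) * exp (- x / b) * gamma_series a (l * x / b))"
    using assms by (intro log_concave_on_mult log_concave_on_const log_concave_on_powr) auto
  then show ?thesis
    using assms by (subst log_concave_on_cong) (auto simp: noncentral_gamma_density_eq)
qed

text \<open>On \<open>(0, x]\<close> the exponential is at least its value at \<open>x\<close>, and
  the series is at least its constant term \<open>1 / Gamma a\<close>. The companion upper bound
  takes the exponential at 0 and the series at \<open>x\<close>.\<close>

lemma noncentral_gamma_density_lower: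
  assumes "0 < a" "0 < b" "0 \<le> l" "0 < y" "y \<le> x"
  shows "exp (- l) / b powr a * exp (- x / b) / Gamma a * y powr (a - 1) \<le> noncentral_gamma_density a b l y"
proof -
  have "exp (- l) / b powr a * (y powr (a - 1) * exp (- x / b) * (1 / Gamma a))
     \<le> exp (- l) / b powr a * (y powr (a - 1) * exp (- y / b) * gamma_series a (l * y / b))"
    using assms Gamma_real_pos[of a] gamma_series_ge_term[of a "l * y / b" 0]
    by (intro mult_left_mono mult_mono) (auto simp: divide_right_mono less_imp_le)
  then show ?thesis using assms by (simp add: noncentral_gamma_density_eq mult_ac)
qed

lemma noncentral_gamma_density_upper:
  assumes "0 < a" "0 < b" "0 \<le> l" "0 < y" "y \<le> x"
  shows "noncentral_gamma_density a b l y \<le> exp (- l) / b powr a * gamma_series a (l * x / b) * y powr (a - 1)"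
proof -
  have "exp (- l) / b powr a * (y powr (a - 1) * (exp (- y / b) * gamma_series a (l * y / b)))
     \<le> exp (- l) / b powr a * (y powr (a - 1) * (1 * gamma_series a (l * x / b)))"
    using assms gamma_series_pos[of a "l * y / b"]
    by (intro mult_left_mono mult_mono gamma_series_mono)
       (auto simp: divide_right_mono mult_left_mono less_imp_le)
  then show ?thesis using assms by (simp add: noncentral_gamma_density_eq mult_ac)
qed

text \<open>Scaling \<open>y = x * t\<close> reduces to the unit interval: the two powers contribute
  the exponent \<open>p + q - 2\<close>, the Jacobian one more.\<close>

lemma has_bochner_integral_Beta:
  fixes p q x :: real
  assumes p: "0 < p" and q: "0 < q" and x: "0 < x"
  shows "has_bochner_integral lborel (\<lambda>y. indicator {0<..<x} y * ((x - y) powr (p - 1) * y powr (q - 1)))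
    (x powr (p + q - 1) * Beta p q)"
proof -
  define k where "k t = indicator {0<..<1} t * ((1 - t) powr (p - 1) * t powr (q - 1))" for t :: real
  have [measurable]: "k \<in> borel_measurable borel" unfolding k_def by measurable
  have k_nn: "0 \<le> k t" for t by (simp add: k_def)
  have "(k has_integral Beta q p) UNIV"
  proof -
    have "((\<lambda>t. t powr (q - 1) * (1 - t) powr (p - 1)) has_integral Beta q p) {0<..<1}"
      using has_integral_Beta_real[OF q p] by (simp add: has_integral_Icc_iff_Ioo)
    then have "((\<lambda>t. if t \<in> {0<..<1} then t powr (q - 1) * (1 - t) powr (p - 1) else 0)
        has_integral Beta q p) UNIV" by (simp only: has_integral_restrict_UNIV)
    moreover have "k = (\<lambda>t. if t \<in> {0<..<1} then t powr (q - 1) * (1 - t) powr (p - 1) else 0)"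
      by (auto simp: k_def fun_eq_iff indicator_def)
    ultimately show ?thesis by simp
  qed
  \<comment> \<open>The Beta formula is stated for the gauge integral; nonnegativity of
    \<open>k\<close> carries it over to the Lebesgue integral.\<close>
  then have "(\<integral>\<^sup>+ t. ennreal (k t) \<partial>lborel) = ennreal (Beta q p)"
    using nn_integral_has_integral_lborel[of k "Beta q p"] by (simp add: k_nn)
  then have "has_bochner_integral lborel k (Beta p q)"
    using p q by (intro has_bochner_integral_nn_integral)
      (auto simp: k_nn Beta_commute Beta_def intro!: divide_nonneg_nonneg mult_nonneg_nonneg Gamma_real_nonneg)
  then have "has_bochner_integral lborel (\<lambda>y. k (0 + 1 / x * y)) (Beta p q /\<^sub>R \<bar>1 / x\<bar>)"
    using x by (subst (asm) lborel_has_bochner_integral_real_affine_iff[where c = "1 / x" and t = 0]) auto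
  then have "has_bochner_integral lborel (\<lambda>y. x powr (p + q - 2) * k (y / x)) (x powr (p + q - 2) * (x * Beta p q))"
    using x by (intro has_bochner_integral_mult_right) auto
  moreover have "x powr (p + q - 2) * (x * Beta p q) = x powr (p + q - 1) * Beta p q"
    using x powr_add[of x "p + q - 2" 1] by simp
  moreover have "x powr (p + q - 2) * k (y / x) = indicator {0<..<x} y * ((x - y) powr (p - 1) * y powr (q - 1))" for y
  proof (cases "0 < y \<and> y < x")
    case True
    have "1 - y / x = (x - y) / x" using x by (simp add: field_simps)
    moreover have "x powr (p + q - 2) = x powr (p - 1) * x powr (q - 1)"
      by (simp flip: powr_add)
    ultimately show ?thesis using True x by (simp add: k_def powr_divide)
  next
    case False
    then show ?thesis using x by (auto simp: k_def indicator_def field_simps)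
  qed
  ultimately show ?thesis by simp
qed

text \<open>The pointwise bounds squeeze the integrand between two multiples of the Beta kernel.
  Integrability, positivity and the exponent at the origin all follow from this one
  comparison.\<close>

lemma noncentral_gamma_sum_density_bounds:
  assumes ab: "0 < a1" "0 < b1" "0 \<le> l1" "0 < a2" "0 < b2" "0 \<le> l2" and x: "0 < x"
  defines "\<phi> \<equiv> \<lambda>y. noncentral_gamma_density a1 b1 l1 (x - y) * noncentral_gamma_density a2 b2 l2 y"
  shows noncentral_gamma_sum_integrable: "set_integrable lborel {0<..<x} \<phi>"
    and noncentral_gamma_sum_density_lower:
      "(exp (- l1) / b1 powr a1 * exp (- x / b1) / Gamma a1) * (exp (- l2) / b2 powr a2 * exp (- x / b2) / Gamma a2)
          * (x powr (a1 + a2 - 1) * Beta a1 a2)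
        \<le> noncentral_gamma_sum_density a1 b1 l1 a2 b2 l2 x"
    and noncentral_gamma_sum_density_upper:
      "noncentral_gamma_sum_density a1 b1 l1 a2 b2 l2 x
        \<le> (exp (- l1) / b1 powr a1 * gamma_series a1 (l1 * x / b1))
          * (exp (- l2) / b2 powr a2 * gamma_series a2 (l2 * x / b2))
          * (x powr (a1 + a2 - 1) * Beta a1 a2)"
proof -
  let ?B = "\<lambda>y. indicator {0<..<x} y * ((x - y) powr (a1 - 1) * y powr (a2 - 1))"
  let ?\<phi> = "\<lambda>y. indicator {0<..<x} y * \<phi> y"
  define K where "K = (exp (- l1) / b1 powr a1 * exp (- x / b1) / Gamma a1)
    * (exp (- l2) / b2 powr a2 * exp (- x / b2) / Gamma a2)"
  define L where "L = (exp (- l1) / b1 powr a1 * gamma_series a1 (l1 * x / b1))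
    * (exp (- l2) / b2 powr a2 * gamma_series a2 (l2 * x / b2))"
  have [measurable]: "\<phi> \<in> borel_measurable borel" unfolding \<phi>_def by measurable
  note B = has_bochner_integral_Beta[OF ab(1,4) x]
  have Bint: "integrable lborel ?B" "integral\<^sup>L lborel ?B = x powr (a1 + a2 - 1) * Beta a1 a2"
    using B by (simp_all add: has_bochner_integral_iff)
  have Lint: "integrable lborel (\<lambda>y. L * ?B y)" using Bint by simp
  have nn: "0 \<le> \<phi> y" for y using ab by (simp add: \<phi>_def noncentral_gamma_density_nonneg)
  have up: "?\<phi> y \<le> L * ?B y" for y
  proof (cases "y \<in> {0<..<x}")
    case True
    then have "\<phi> y \<le> (exp (- l1) / b1 powr a1 * gamma_series a1 (l1 * x / b1) * (x - y) powr (a1 - 1))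
        * (exp (- l2) / b2 powr a2 * gamma_series a2 (l2 * x / b2) * y powr (a2 - 1))"
      unfolding \<phi>_def using ab
      by (intro mult_mono' noncentral_gamma_density_upper noncentral_gamma_density_nonneg) auto
    then show ?thesis using True by (simp add: L_def mult_ac)
  qed simp
  have lo: "K * ?B y \<le> ?\<phi> y" for y
  proof (cases "y \<in> {0<..<x}")
    case True
    then have "(exp (- l1) / b1 powr a1 * exp (- x / b1) / Gamma a1 * (x - y) powr (a1 - 1))
        * (exp (- l2) / b2 powr a2 * exp (- x / b2) / Gamma a2 * y powr (a2 - 1)) \<le> \<phi> y"
      unfolding \<phi>_def using ab Gamma_real_pos[of a1] Gamma_real_pos[of a2]
      by (intro mult_mono' noncentral_gamma_density_lower) auto
    then show ?thesis using True by (simp add: K_def mult_ac)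
  qed simp
  have int: "integrable lborel ?\<phi>"
    by (rule Bochner_Integration.integrable_bound[OF Lint])
      (use up nn in \<open>auto intro: order_trans[OF _ abs_ge_self]\<close>)
  then show "set_integrable lborel {0<..<x} \<phi>" by (simp add: set_integrable_def)
  have p: "noncentral_gamma_sum_density a1 b1 l1 a2 b2 l2 x = integral\<^sup>L lborel ?\<phi>"
    by (simp add: noncentral_gamma_sum_density_def set_lebesgue_integral_def \<phi>_def)
  have "integral\<^sup>L lborel ?\<phi> \<le> integral\<^sup>L lborel (\<lambda>y. L * ?B y)"
    using int Lint up by (rule integral_mono)
  then show "noncentral_gamma_sum_density a1 b1 l1 a2 b2 l2 x
        \<le> (exp (- l1) / b1 powr a1 * gamma_series a1 (l1 * x / b1))
          * (exp (- l2) / b2 powr a2 * gamma_series a2 (l2 * x / b2))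
          * (x powr (a1 + a2 - 1) * Beta a1 a2)"
    using Bint(2) unfolding p by (simp add: L_def)
  have "integral\<^sup>L lborel (\<lambda>y. K * ?B y) \<le> integral\<^sup>L lborel ?\<phi>"
    using int Bint lo by (intro integral_mono) auto
  then show "(exp (- l1) / b1 powr a1 * exp (- x / b1) / Gamma a1) * (exp (- l2) / b2 powr a2 * exp (- x / b2) / Gamma a2)
          * (x powr (a1 + a2 - 1) * Beta a1 a2)
        \<le> noncentral_gamma_sum_density a1 b1 l1 a2 b2 l2 x"
    using Bint(2) unfolding p by (simp add: K_def)
qed

lemma Beta_real_pos: "0 < p \<Longrightarrow> 0 < q \<Longrightarrow> 0 < Beta p (q :: real)"
  by (simp add: Beta_def Gamma_real_pos)

lemma noncentral_gamma_sum_density_pos: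
  assumes ab: "0 < a1" "0 < b1" "0 \<le> l1" "0 < a2" "0 < b2" "0 \<le> l2" and x: "0 < x"
  shows "0 < noncentral_gamma_sum_density a1 b1 l1 a2 b2 l2 x"
  by (rule less_le_trans[OF _ noncentral_gamma_sum_density_lower[OF assms]])
    (use assms in \<open>simp add: Gamma_real_pos Beta_real_pos\<close>)

lemma log_concave_on_noncentral_gamma_sum_density:
  assumes "1 \<le> a1" "0 < b1" "0 \<le> l1" "1 \<le> a2" "0 < b2" "0 \<le> l2"
  shows "log_concave_on {0<..} (noncentral_gamma_sum_density a1 b1 l1 a2 b2 l2)"
  unfolding noncentral_gamma_sum_density_def
proof (rule log_concave_on_convolution)
  fix x :: real assume "0 < x"
  then show "0 < (LBINT y:{0<..<x}. noncentral_gamma_density a1 b1 l1 (x - y) * noncentral_gamma_density a2 b2 l2 y)"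
    using noncentral_gamma_sum_density_pos[of a1 b1 l1 a2 b2 l2 x] assms
    by (simp add: noncentral_gamma_sum_density_def)
qed (use assms in \<open>auto intro: log_concave_on_noncentral_gamma_density\<close>)

section \<open>Log-convexity through reciprocals and mixtures\<close>

lemma log_convex_on_iff_inverse:
  "log_convex_on I h \<longleftrightarrow> log_concave_on I (\<lambda>x. inverse (h x))"
proof (cases "is_interval I \<and> (\<forall>x\<in>I. 0 < h x)")
  case True
  have "(h (t * x + (1 - t) * y) \<le> h x powr t * h y powr (1 - t)) \<longleftrightarrow>
      (inverse (h x) powr t * inverse (h y) powr (1 - t) \<le> inverse (h (t * x + (1 - t) * y)))"
    if "x \<in> I" "y \<in> I" "t \<in> {0..1}" for x y t
  proof -
    have "t * x + (1 - t) * y \<in> I"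
      using True that convexD[of I x y t "1 - t"] by (simp add: is_interval_convex_1)
    then have "0 < h (t * x + (1 - t) * y)" using True by blast
    moreover have "0 < h x powr t * h y powr (1 - t)" using True that by (intro mult_pos_pos) (force simp: less_imp_neq[symmetric])+
    ultimately show ?thesis
      by (simp add: inverse_powr flip: inverse_mult_distrib)
  qed
  then show ?thesis using True by (simp add: log_convex_on_def log_concave_on_def)
qed (auto simp: log_convex_on_def log_concave_on_def)

text \<open>This is Hoelder's inequality: after division by the two integrals, weighted AM-GM
  applies pointwise, and the normalised right-hand side integrates to
  \<open>t + (1 - t)\<close>.\<close>

lemma log_convex_on_integral:
  fixes k :: "real \<Rightarrow> real \<Rightarrow> real"
  assumes I: "is_interval I"
    and int: "\<And>x. x \<in> I \<Longrightarrow> integrable lborel (k x)"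
    and pos: "\<And>x. x \<in> I \<Longrightarrow> 0 < (LBINT u. k x u)"
    and nn: "\<And>x u. x \<in> I \<Longrightarrow> 0 \<le> k x u"
    and k: "\<And>x y t u. x \<in> I \<Longrightarrow> y \<in> I \<Longrightarrow> t \<in> {0..1} \<Longrightarrow>
      k (t * x + (1 - t) * y) u \<le> k x u powr t * k y u powr (1 - t)"
  shows "log_convex_on I (\<lambda>x. LBINT u. k x u)"
  unfolding log_convex_on_def
proof (intro conjI ballI I pos)
  fix x y t assume xy: "x \<in> I" "y \<in> I" and t: "t \<in> {0..1::real}"
  define A where "A = (LBINT u. k x u)"
  define B where "B = (LBINT u. k y u)"
  have AB: "0 < A" "0 < B" using pos xy by (auto simp: A_def B_def)
  have z: "t * x + (1 - t) * y \<in> I"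
    using I xy t convexD[of I x y t "1 - t"] by (simp add: is_interval_convex_1)
  \<comment> \<open>Zeros of the integrand are harmless, since \<open>0 powr r\<close> is 0 for
    every \<open>r\<close>, including 0.\<close>
  have young: "p powr t * q powr (1 - t) \<le> t * p + (1 - t) * q" if "0 \<le> p" "0 \<le> q" for p q :: real
    using that t Youngs_inequality_0[of t "1 - t" p q] by (cases "p = 0 \<or> q = 0") auto
  have "k (t * x + (1 - t) * y) u \<le> A powr t * B powr (1 - t) * (t / A * k x u + (1 - t) / B * k y u)" for u
  proof -
    have "k (t * x + (1 - t) * y) u \<le> k x u powr t * k y u powr (1 - t)" using k xy t by blast
    also have "\<dots> = A powr t * B powr (1 - t) * ((k x u / A) powr t * (k y u / B) powr (1 - t))"
      using AB by (simp add: powr_divide)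
    also have "\<dots> \<le> A powr t * B powr (1 - t) * (t * (k x u / A) + (1 - t) * (k y u / B))"
      using nn xy AB by (intro mult_left_mono young) auto
    finally show ?thesis by simp
  qed
  then have "(LBINT u. k (t * x + (1 - t) * y) u)
      \<le> (LBINT u. A powr t * B powr (1 - t) * (t / A * k x u + (1 - t) / B * k y u))"
    using int xy z by (intro integral_mono) auto
  also have "\<dots> = A powr t * B powr (1 - t) * (t / A * A + (1 - t) / B * B)"
    using int xy by (simp add: A_def B_def)
  also have "\<dots> = A powr t * B powr (1 - t)" using AB by simp
  finally show "(LBINT u. k (t * x + (1 - t) * y) u)
      \<le> (LBINT u. k x u) powr t * (LBINT u. k y u) powr (1 - t)" by (simp add: A_def B_def)
qed

section \<open>Obstructions to log-convexity and log-concavity\<close>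

text \<open>The midpoint inequality at 1 gives \<open>(h 1)\<^sup>2 \<le> h e * h (2 - e)\<close>,
  whose right-hand side vanishes as \<open>e\<close> tends to 0.\<close>

lemma not_log_convex_on_if_le_powr:
  assumes r: "0 < r" and h: "\<And>x. 0 < x \<Longrightarrow> x < 2 \<Longrightarrow> h x \<le> C * x powr r"
  shows "\<not> log_convex_on {0<..} h"
proof
  assume conv: "log_convex_on {0<..} h"
  then have pos: "0 < h x" if "0 < x" for x using that by (simp add: log_convex_on_def)
  have "0 < C" using h[of 1] pos[of 1] by simp
  have bound: "(h 1)\<^sup>2 \<le> C\<^sup>2 * (e * 2) powr r" if e: "0 < e" "e < 1" for e
  proof -
    have p: "0 < h e" "0 < h (2 - e)" using e by (auto intro: pos)
    have "\<forall>t\<in>{0..1}. h (t * e + (1 - t) * (2 - e)) \<le> h e powr t * h (2 - e) powr (1 - t)"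
      using conv e by (simp add: log_convex_on_def)
    from bspec[OF this, of "1 / 2"] have "h 1 \<le> sqrt (h e * h (2 - e))"
      using p by (simp add: powr_half_sqrt real_sqrt_mult flip: add_divide_distrib)
    then have "(h 1)\<^sup>2 \<le> (sqrt (h e * h (2 - e)))\<^sup>2"
      using pos[of 1] by (intro power_mono) auto
    also have "\<dots> = h e * h (2 - e)" using p by simp
    also have "\<dots> \<le> (C * e powr r) * (C * (2 - e) powr r)"
      using h[of e] h[of "2 - e"] e p by (intro mult_mono) (auto simp: \<open>0 < C\<close> less_imp_le)
    also have "\<dots> \<le> (C * e powr r) * (C * 2 powr r)"
      using e r \<open>0 < C\<close> by (intro mult_left_mono powr_mono2) auto
    finally show ?thesis by (simp add: powr_mult power2_eq_square mult_ac)
  qed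
  have "((\<lambda>e. C\<^sup>2 * (e * 2) powr r) \<longlongrightarrow> 0) (at_right 0)" using r by real_asymp
  then have "eventually (\<lambda>e. C\<^sup>2 * (e * 2) powr r < (h 1)\<^sup>2) (at_right 0)"
    using pos[of 1] by (auto intro: order_tendstoD)
  moreover have "eventually (\<lambda>e::real. 0 < e \<and> e < 1) (at_right 0)"
    by (auto simp: eventually_at_right_field intro!: exI[of _ 1])
  ultimately have "eventually (\<lambda>e::real. False) (at_right 0)"
    by eventually_elim (use bound in fastforce)
  then show False by simp
qed

lemma not_log_concave_on_if_ge_powr:
  assumes r: "r < 0" and C: "0 < C" and h: "\<And>x. 0 < x \<Longrightarrow> x < 2 \<Longrightarrow> C * x powr r \<le> h x"
  shows "\<not> log_concave_on {0<..} h"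
proof -
  have "\<not> log_convex_on {0<..} (\<lambda>x. inverse (h x))"
  proof (rule not_log_convex_on_if_le_powr)
    show "0 < - r" using r by simp
    fix x :: real assume x: "0 < x" "x < 2"
    then have "inverse (h x) \<le> inverse (C * x powr r)"
      using C h[OF x] by (intro le_imp_inverse_le) auto
    then show "inverse (h x) \<le> inverse C * x powr (- r)" by (simp add: powr_minus)
  qed
  then show ?thesis by (simp add: log_convex_on_iff_inverse)
qed

text \<open>To the right of \<open>x2\<close> the concave function \<open>ln (G x)\<close> stays
  below its secant line through \<open>x1\<close> and \<open>x2\<close>; the rate \<open>s\<close>
  is minus the slope of that line.\<close>

lemma log_concave_on_exponential_decay:
  assumes G: "log_concave_on {0<..} G" and x: "0 < x1" "x1 < x2" and less: "G x2 < G x1"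
  obtains s where "0 < s" "\<And>x. x2 \<le> x \<Longrightarrow> G x \<le> G x2 * exp (- s * (x - x2))"
proof
  have pos: "0 < G x" if "0 < x" for x using G that by (simp add: log_concave_on_def)
  define L where "L x = ln (G x)" for x
  define s where "s = (L x1 - L x2) / (x2 - x1)"
  show "0 < s" using less pos x by (simp add: s_def L_def)
  fix x assume "x2 \<le> x"
  with x have *: "0 < x" "0 < x - x1" by simp_all
  \<comment> \<open>The weight that places \<open>x2\<close> between \<open>x1\<close> and
    \<open>x\<close>.\<close>
  define t where "t = (x - x2) / (x - x1)"
  have t: "t \<in> {0..1}" using \<open>x2 \<le> x\<close> x * by (simp add: t_def)
  have t': "t * (x - x1) = x - x2" using * by (simp add: t_def)
  then have eq: "t * x1 + (1 - t) * x = x2" by (simp add: algebra_simps)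
  have "t * L x1 + (1 - t) * L x \<le> L x2"
    using log_concave_on_lnD[OF G, of x1 x t] x * t by (simp add: L_def eq)
  then have "(x - x1) * (t * L x1 + (1 - t) * L x) \<le> (x - x1) * L x2"
    using * by (intro mult_left_mono) auto
  also have "(x - x1) * (t * L x1 + (1 - t) * L x)
      = (t * (x - x1)) * L x1 + ((x - x1) - t * (x - x1)) * L x" by (simp add: algebra_simps)
  also have "\<dots> = (x - x2) * L x1 + (x2 - x1) * L x" by (simp add: t')
  finally have "(x2 - x1) * L x \<le> (x2 - x1) * L x2 - (x - x2) * (L x1 - L x2)"
    by (simp add: algebra_simps)
  also have "\<dots> = (x2 - x1) * (L x2 + - s * (x - x2))"
    using x by (simp add: s_def field_simps)
  finally have "L x \<le> L x2 + - s * (x - x2)" using x by simp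
  then have "exp (L x) \<le> exp (L x2 + - s * (x - x2))" by simp
  then have "exp (L x) \<le> exp (L x2) * exp (- s * (x - x2))" by (simp only: exp_add)
  then show "G x \<le> G x2 * exp (- s * (x - x2))" using pos[of x] pos[of x2] x * by (simp add: L_def)
qed

text \<open>The upper bound forces \<open>G\<close> to drop below \<open>G 1\<close> somewhere. A
  log-concave function then decays exponentially, which the lower power bound forbids.\<close>

lemma not_log_concave_on_if_between_powr:
  assumes r: "r < 0" and c: "0 < c" and G: "\<And>x. 1 \<le> x \<Longrightarrow> c * x powr r \<le> G x \<and> G x \<le> C * x powr r"
  shows "\<not> log_concave_on {0<..} G"
proof
  assume conc: "log_concave_on {0<..} G"
  then have pos: "0 < G x" if "0 < x" for x using that by (simp add: log_concave_on_def)
  have "((\<lambda>x. C * x powr r) \<longlongrightarrow> 0) at_top" using r by real_asymp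
  then have "eventually (\<lambda>x. C * x powr r < G 1 \<and> 1 < x) at_top"
    using pos[of 1] by (intro eventually_conj order_tendstoD(2)[of _ 0] eventually_gt_at_top) auto
  from eventually_happens'[OF trivial_limit_at_top_linorder this]
  obtain x2 where x2: "C * x2 powr r < G 1" "1 < x2" by blast
  then have "G x2 < G 1" using G[of x2] by simp
  then obtain s where s: "0 < s" "\<And>x. x2 \<le> x \<Longrightarrow> G x \<le> G x2 * exp (- s * (x - x2))"
    using log_concave_on_exponential_decay[OF conc, of 1 x2] x2 by auto
  have "((\<lambda>x. G x2 * exp (- s * (x - x2)) / (c * x powr r)) \<longlongrightarrow> 0) at_top"
    using s(1) c r by real_asymp
  then have "eventually (\<lambda>x. G x2 * exp (- s * (x - x2)) / (c * x powr r) < 1) at_top"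
    by (rule order_tendstoD) simp
  moreover have "eventually (\<lambda>x. x2 \<le> x) at_top" by (rule eventually_ge_at_top)
  ultimately have "eventually (\<lambda>x. G x2 * exp (- s * (x - x2)) / (c * x powr r) < 1 \<and> x2 \<le> x) at_top"
    by (rule eventually_conj)
  from eventually_happens'[OF trivial_limit_at_top_linorder this]
  obtain x where x: "G x2 * exp (- s * (x - x2)) / (c * x powr r) < 1" "x2 \<le> x" by blast
  then have "G x2 * exp (- s * (x - x2)) < c * x powr r" using c x2 by (simp add: field_simps)
  then show False using s(2)[of x] G[of x] x2 x by auto
qed

section \<open>Central summands with different scales\<close>

lemma noncentral_gamma_sum_density_commute:
  "noncentral_gamma_sum_density a1 b1 l1 a2 b2 l2 x = noncentral_gamma_sum_density a2 b2 l2 a1 b1 l1 x"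
proof -
  have "noncentral_gamma_sum_density a1 b1 l1 a2 b2 l2 x
    = (LBINT y. indicator {0<..<x} (x + (-1) * y) * (noncentral_gamma_density a1 b1 l1 (x - (x + (-1) * y)) *
                        noncentral_gamma_density a2 b2 l2 (x + (-1) * y)))"
    unfolding noncentral_gamma_sum_density_def set_lebesgue_integral_def
    by (subst lborel_integral_real_affine[where c = "-1" and t = x]) auto
  also have "\<dots> = noncentral_gamma_sum_density a2 b2 l2 a1 b1 l1 x"
    unfolding noncentral_gamma_sum_density_def set_lebesgue_integral_def
    by (intro Bochner_Integration.integral_cong) (auto simp: indicator_def)
  finally show ?thesis .
qed

text \<open>Multiplication by \<open>exp (x / b1)\<close>, which preserves log-concavity, leaves the
  convolution of the power \<open>a - 1\<close> with the kernel \<open>k\<close>. As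
  \<open>k\<close> is integrable, most of its mass sits near 0, and the convolution inherits the
  order of the power.\<close>

lemma not_log_concave_on_central_gamma_sum_density:
  assumes a: "0 < a" "a < 1" and b: "0 < b2" "b2 < b1"
  shows "\<not> log_concave_on {0<..} (noncentral_gamma_sum_density a b1 0 a b2 0)"
proof
  let ?p = "noncentral_gamma_sum_density a b1 0 a b2 0"
  assume conc: "log_concave_on {0<..} ?p"
  define d where "d = 1 / b2 - 1 / b1"
  have d: "0 < d" using b by (simp add: d_def field_simps)
  define K where "K = 1 / (b1 powr a * Gamma a) * (1 / (b2 powr a * Gamma a))"
  have K: "0 < K" using a b by (simp add: K_def Gamma_real_pos)
  define k where "k y = indicator {0<..} y * (y powr (a - 1) * exp (- d * y))" for y :: real
  define \<psi> where "\<psi> x y = indicator {0<..<x} y * ((x - y) powr (a - 1) * (y powr (a - 1) * exp (- d * y)))" for x y :: real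
  have [measurable]: "k \<in> borel_measurable borel" unfolding k_def by measurable
  have [measurable]: "\<psi> x \<in> borel_measurable borel" for x unfolding \<psi>_def by measurable
  have p_eq: "exp (1 / b1 * x) * ?p x = K * (LBINT y. \<psi> x y)" if x: "0 < x" for x
  proof -
    have "?p x = (LBINT y. (K * exp (- (1 / b1 * x))) * \<psi> x y)"
      unfolding noncentral_gamma_sum_density_def set_lebesgue_integral_def
    proof (rule Bochner_Integration.integral_cong)
      fix y
      show "indicat_real {0<..<x} y *\<^sub>R (noncentral_gamma_density a b1 0 (x - y) * noncentral_gamma_density a b2 0 y)
          = (K * exp (- (1 / b1 * x))) * \<psi> x y"
      proof (cases "y \<in> {0<..<x}")
        case True
        have "exp (- (x - y) / b1) * exp (- y / b2) = exp (- (1 / b1 * x)) * exp (- d * y)"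
          unfolding exp_add[symmetric] by (simp add: d_def algebra_simps diff_divide_distrib)
        moreover have "noncentral_gamma_density a b1 0 (x - y) * noncentral_gamma_density a b2 0 y
            = K * (x - y) powr (a - 1) * y powr (a - 1) * (exp (- (x - y) / b1) * exp (- y / b2))"
          using True by (simp add: noncentral_gamma_density_central K_def)
        ultimately show ?thesis using True by (simp add: \<psi>_def)
      qed (simp add: \<psi>_def)
    qed simp
    then show ?thesis by (simp add: exp_minus)
  qed
  have \<psi>_int: "integrable lborel (\<psi> x)" if x: "0 < x" for x
  proof (rule Bochner_Integration.integrable_bound)
    show "integrable lborel (\<lambda>y. indicator {0<..<x} y * ((x - y) powr (a - 1) * y powr (a - 1)))"
      using has_bochner_integral_Beta[OF a(1) a(1) x] by (simp add: has_bochner_integral_iff)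
    have "(x - y) powr (a - 1) * (y powr (a - 1) * exp (- d * y)) \<le> (x - y) powr (a - 1) * (y powr (a - 1) * 1)"
      if "0 < y" for y
      using d that by (intro mult_left_mono) auto
    then show "AE y in lborel. norm (\<psi> x y) \<le> norm (indicator {0<..<x} y * ((x - y) powr (a - 1) * y powr (a - 1)))"
      by (auto simp: \<psi>_def indicator_def)
  qed simp
  have k_int: "integrable lborel k"
  proof -
    \<comment> \<open>\<open>k\<close> is a multiple of the central gamma density with scale
      \<open>1 / d\<close>.\<close>
    have "integrable lborel (noncentral_gamma_density a (1 / d) 0)"
      using nn_integral_noncentral_gamma_density[of a "1 / d" 0] a d
      by (intro integrableI_nn_integral_finite[where x = 1])
         (auto intro!: noncentral_gamma_density_nonneg)
    then have "integrable lborel (\<lambda>x. ((1 / d) powr a * Gamma a) * noncentral_gamma_density a (1 / d) 0 x)"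
      by simp
    also have "(\<lambda>x. ((1 / d) powr a * Gamma a) * noncentral_gamma_density a (1 / d) 0 x) = k"
    proof
      fix x
      show "((1 / d) powr a * Gamma a) * noncentral_gamma_density a (1 / d) 0 x = k x"
      proof (cases "0 < x")
        case True
        then show ?thesis
          using a d Gamma_real_pos[OF a(1)]
          by (simp add: noncentral_gamma_density_central k_def mult.commute less_imp_neq[symmetric])
      qed (simp add: noncentral_gamma_density_def k_def)
    qed
    finally show ?thesis .
  qed
  have k_int': "integrable lborel (\<lambda>y. k (x - y))" "(LBINT y. k (x - y)) = (LBINT y. k y)" for x
    using lborel_integrable_real_affine[OF k_int, of "-1" x]
      lborel_integral_real_affine[of "-1" k x] by simp_all
  \<comment> \<open>The part \<open>0 < y < 1\<close> suffices: as \<open>a - 1\<close> is negative,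
    \<open>(x - y) powr (a - 1)\<close> is at least \<open>x powr (a - 1)\<close> and
    \<open>y powr (a - 1)\<close> at least 1.\<close>
  have lower: "exp (- d) * x powr (a - 1) \<le> (LBINT y. \<psi> x y)" if x: "1 \<le> x" for x
  proof -
    have "(LBINT y. (exp (- d) * x powr (a - 1)) * indicator {0<..<1::real} y) \<le> (LBINT y. \<psi> x y)"
    proof (rule integral_mono)
      fix y :: real
      show "(exp (- d) * x powr (a - 1)) * indicator {0<..<1} y \<le> \<psi> x y"
      proof (cases "y \<in> {0<..<1}")
        case True
        have "x powr (a - 1) * (1 * exp (- d)) \<le> (x - y) powr (a - 1) * (y powr (a - 1) * exp (- d * y))"
          using True x a d powr_mono2'[of "a - 1" y 1] by (intro mult_mono powr_mono2') auto
        then show ?thesis using True x by (simp add: \<psi>_def mult.commute)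
      qed (simp add: \<psi>_def)
    qed (use \<psi>_int x in \<open>auto intro!: integrable_mult_right integrable_real_indicator\<close>)
    then show ?thesis by simp
  qed
  \<comment> \<open>Split at \<open>x / 2\<close> and bound the power of the larger of
    \<open>y\<close> and \<open>x - y\<close>. In the right half \<open>y\<close> is at least
    \<open>x - y\<close>, so the remaining factor is at most the reflected kernel
    \<open>k (x - y)\<close>.\<close>
  have upper: "(LBINT y. \<psi> x y) \<le> (x / 2) powr (a - 1) * (2 * (LBINT y. k y))" if x: "0 < x" for x
  proof -
    have "\<psi> x y \<le> (x / 2) powr (a - 1) * (k y + k (x - y))" for y
    proof (cases "y \<in> {0<..<x}")
      case True
      have "(x - y) powr (a - 1) * (y powr (a - 1) * exp (- d * y))
        \<le> (x / 2) powr (a - 1) * (y powr (a - 1) * exp (- d * y))" if "y \<le> x / 2"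
        using that x a by (intro mult_right_mono powr_mono2') auto
      moreover have "y powr (a - 1) * ((x - y) powr (a - 1) * exp (- d * y))
        \<le> (x / 2) powr (a - 1) * ((x - y) powr (a - 1) * exp (- d * (x - y)))" if "x / 2 \<le> y"
        using that x a d True by (intro mult_mono powr_mono2') (auto simp: mult_left_mono)
      moreover have "0 \<le> k y" "0 \<le> k (x - y)" by (simp_all add: k_def)
      ultimately show ?thesis using True
        by (cases "y \<le> x / 2") (auto simp: \<psi>_def k_def distrib_left mult_ac intro: add_increasing add_increasing2)
    qed (simp add: \<psi>_def k_def)
    then have "(LBINT y. \<psi> x y) \<le> (LBINT y. (x / 2) powr (a - 1) * (k y + k (x - y)))"
      using \<psi>_int x k_int k_int' by (intro integral_mono) auto
    then show ?thesis using k_int k_int' by simp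
  qed
  have "\<not> log_concave_on {0<..} (\<lambda>x. exp (1 / b1 * x) * ?p x)"
  proof (rule not_log_concave_on_if_between_powr)
    show "a - 1 < 0" using a by simp
    show "0 < K * exp (- d)" using K by simp
    fix x :: real assume x: "1 \<le> x"
    have "K * (LBINT y. \<psi> x y) \<le> K * ((x / 2) powr (a - 1) * (2 * (LBINT y. k y)))"
      using K upper[of x] x by (intro mult_left_mono) auto
    moreover have "K * (exp (- d) * x powr (a - 1)) \<le> K * (LBINT y. \<psi> x y)"
      using K lower[OF x] by (intro mult_left_mono) auto
    ultimately show "K * exp (- d) * x powr (a - 1) \<le> exp (1 / b1 * x) * ?p x \<and>
      exp (1 / b1 * x) * ?p x \<le> K * (2 * (LBINT y. k y)) / 2 powr (a - 1) * x powr (a - 1)"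
      using x p_eq[of x] by (simp add: powr_divide mult_ac)
  qed
  then show False using log_concave_on_mult[OF log_concave_on_exp conc] by blast
qed

section \<open>The density of the sum\<close>

text \<open>Expand the product of the series by total degree \<open>n\<close>. Each monomial pair
  integrates to a Beta value whose numerator cancels both Gamma factors, leaving
  \<open>Gamma (a1 + a2 + n)\<close> for all \<open>i\<close>; the factorials then assemble
  \<open>(c1 + c2) ^ n / fact n\<close> by the binomial theorem.\<close>

lemma integral_gamma_series_product:
  assumes a: "0 < a1" "0 < a2" and c: "0 \<le> c1" "0 \<le> c2" and x: "0 < x"
  shows "(LBINT y. indicator {0<..<x} y * ((x - y) powr (a1 - 1) * y powr (a2 - 1) *
      (gamma_series a1 (c1 * (x - y)) * gamma_series a2 (c2 * y))))
    = x powr (a1 + a2 - 1) * gamma_series (a1 + a2) ((c1 + c2) * x)"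
proof -
  define A where "A i y = (c1 * (x - y)) ^ i / (fact i * Gamma (a1 + real i))" for i y
  define B where "B j y = (c2 * y) ^ j / (fact j * Gamma (a2 + real j))" for j y
  define U where "U n y = indicator {0<..<x} y *
    ((x - y) powr (a1 - 1) * y powr (a2 - 1) * (\<Sum>i\<le>n. A i y * B (n - i) y))" for n y
  define v where "v n = x powr (a1 + a2 - 1) * (((c1 + c2) * x) ^ n / (fact n * Gamma (a1 + a2 + real n)))" for n
  have Gpos: "0 < Gamma (a1 + real i)" "0 < Gamma (a2 + real i)" "0 < Gamma (a1 + a2 + real i)" for i
    using a by (auto intro!: Gamma_real_pos)
  have U_nn: "0 \<le> U n y" for n y
    using c a gamma_series_term_nonneg[of a1] gamma_series_term_nonneg[of a2]
    by (auto simp: U_def A_def B_def indicator_def intro!: sum_nonneg mult_nonneg_nonneg simp del: of_nat_diff)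
  have pointwise: "(\<lambda>n. U n y) sums (indicator {0<..<x} y * ((x - y) powr (a1 - 1) * y powr (a2 - 1) *
      (gamma_series a1 (c1 * (x - y)) * gamma_series a2 (c2 * y))))" for y
    unfolding U_def gamma_series_def A_def B_def
    using summable_gamma_series_abs[OF a(1)] summable_gamma_series_abs[OF a(2)]
    by (intro sums_mult Cauchy_product_sums) auto
  have U_int: "has_bochner_integral lborel (U n) (v n)" for n
  proof -
    define w where "w i = c1 ^ i * c2 ^ (n - i) / (fact i * fact (n - i) * Gamma (a1 + real i) * Gamma (a2 + real (n - i)))" for i
    have "has_bochner_integral lborel (\<lambda>y. \<Sum>i\<le>n. w i * (indicator {0<..<x} y *
        ((x - y) powr (a1 + real i - 1) * y powr (a2 + real (n - i) - 1))))
        (\<Sum>i\<le>n. w i * (x powr (a1 + real i + (a2 + real (n - i)) - 1) * Beta (a1 + real i) (a2 + real (n - i))))"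
      using a x by (intro has_bochner_integral_sum has_bochner_integral_mult_right has_bochner_integral_Beta) auto
    moreover have "(\<Sum>i\<le>n. w i * (indicator {0<..<x} y *
        ((x - y) powr (a1 + real i - 1) * y powr (a2 + real (n - i) - 1)))) = U n y" for y
    proof (cases "y \<in> {0<..<x}")
      case True
      have "w i * ((x - y) powr (a1 + real i - 1) * y powr (a2 + real (n - i) - 1))
        = (x - y) powr (a1 - 1) * y powr (a2 - 1) * (A i y * B (n - i) y)" for i
      proof -
        have "z powr (p + real m - 1) = z powr (p - 1) * z ^ m" if "0 < z" for z p :: real and m
          using that powr_add[of z "p - 1" "real m"] by (simp add: powr_realpow algebra_simps)
        from this[of "x - y" a1 i] this[of y a2 "n - i"] True show ?thesis
          by (simp add: w_def A_def B_def power_mult_distrib mult_ac)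
      qed
      then show ?thesis using True by (simp add: U_def sum_distrib_left del: of_nat_diff)
    qed (simp add: U_def)
    moreover have "(\<Sum>i\<le>n. w i * (x powr (a1 + real i + (a2 + real (n - i)) - 1) * Beta (a1 + real i) (a2 + real (n - i)))) = v n"
    proof -
      have "w i * (x powr (a1 + real i + (a2 + real (n - i)) - 1) * Beta (a1 + real i) (a2 + real (n - i)))
        = x powr (a1 + a2 - 1) * x ^ n / (fact n * Gamma (a1 + a2 + real n)) * (real (n choose i) * c1 ^ i * c2 ^ (n - i))"
        if i: "i \<le> n" for i
      proof -
        have eq: "a1 + real i + (a2 + real (n - i)) = a1 + a2 + real n" using i by (simp add: of_nat_diff)
        have "x powr (a1 + a2 + real n - 1) = x powr (a1 + a2 - 1) * x ^ n"
          using x powr_add[of x "a1 + a2 - 1" "real n"] by (simp add: powr_realpow algebra_simps)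
        then show ?thesis unfolding Beta_def eq binomial_fact[OF i] w_def
          using Gpos(1)[of i] Gpos(2)[of "n - i"] Gpos(3)[of n] by (simp add: field_simps)
      qed
      then have "(\<Sum>i\<le>n. w i * (x powr (a1 + real i + (a2 + real (n - i)) - 1) * Beta (a1 + real i) (a2 + real (n - i))))
        = x powr (a1 + a2 - 1) * x ^ n / (fact n * Gamma (a1 + a2 + real n)) * (\<Sum>i\<le>n. real (n choose i) * c1 ^ i * c2 ^ (n - i))"
        by (simp add: sum_distrib_left)
      also have "\<dots> = v n" by (simp add: v_def binomial_ring power_mult_distrib mult_ac)
      finally show ?thesis .
    qed
    ultimately show ?thesis by simp
  qed
  have v: "v sums (x powr (a1 + a2 - 1) * gamma_series (a1 + a2) ((c1 + c2) * x))"
    unfolding v_def[abs_def] gamma_series_def using a by (intro sums_mult summable_sums summable_gamma_series) auto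
  have "(\<lambda>n. LBINT y. U n y) sums (LBINT y. \<Sum>n. U n y)"
  \<comment> \<open>All terms are nonnegative, so absolute summability of the integrals is the known
    convergence of \<open>v\<close>.\<close>
  proof (rule sums_integral)
    show "integrable lborel (U n)" for n using U_int by (simp add: has_bochner_integral_iff)
    show "AE y in lborel. summable (\<lambda>n. norm (U n y))"
      using pointwise U_nn by (auto simp: sums_iff)
    show "summable (\<lambda>n. LBINT y. norm (U n y))"
      using U_int U_nn v by (simp add: has_bochner_integral_iff sums_iff)
  qed
  then have "v sums (LBINT y. \<Sum>n. U n y)" using U_int by (simp add: has_bochner_integral_iff)
  then show ?thesis using v pointwise by (simp add: sums_iff)
qed

lemma noncentral_gamma_sum_density_same_scale:
  assumes "0 < a1" "0 < a2" "0 < b" "0 \<le> l1" "0 \<le> l2" "0 < x"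
  shows "noncentral_gamma_sum_density a1 b l1 a2 b l2 x = noncentral_gamma_density (a1 + a2) b (l1 + l2) x"
proof -
  define C where "C = exp (- l1) / b powr a1 * (exp (- l2) / b powr a2) * exp (- x / b)"
  have "noncentral_gamma_sum_density a1 b l1 a2 b l2 x
    = (LBINT y. C * (indicator {0<..<x} y * ((x - y) powr (a1 - 1) * y powr (a2 - 1) *
      (gamma_series a1 (l1 / b * (x - y)) * gamma_series a2 (l2 / b * y)))))"
    unfolding noncentral_gamma_sum_density_def set_lebesgue_integral_def
  proof (rule Bochner_Integration.integral_cong)
    fix y
    have "exp (- x / b) = exp (- (x - y) / b) * exp (- y / b)"
      unfolding exp_add[symmetric] by (simp add: diff_divide_distrib)
    then show "indicat_real {0<..<x} y *\<^sub>R (noncentral_gamma_density a1 b l1 (x - y) * noncentral_gamma_density a2 b l2 y)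
      = C * (indicator {0<..<x} y * ((x - y) powr (a1 - 1) * y powr (a2 - 1) *
      (gamma_series a1 (l1 / b * (x - y)) * gamma_series a2 (l2 / b * y))))"
      using assms by (cases "y \<in> {0<..<x}") (simp_all add: noncentral_gamma_density_eq C_def)
  qed simp
  also have "\<dots> = C * (x powr (a1 + a2 - 1) * gamma_series (a1 + a2) ((l1 / b + l2 / b) * x))"
    using integral_gamma_series_product[of a1 a2 "l1 / b" "l2 / b" x] assms by simp
  also have "\<dots> = noncentral_gamma_density (a1 + a2) b (l1 + l2) x"
  proof -
    have "(l1 + l2) * x / b = (l1 / b + l2 / b) * x" by (simp add: add_divide_distrib distrib_right)
    moreover have "exp (- (l1 + l2)) / b powr (a1 + a2) = exp (- l1) / b powr a1 * (exp (- l2) / b powr a2)"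
      by (simp add: powr_add exp_diff exp_minus field_simps exp_add)
    ultimately show ?thesis using assms by (simp add: noncentral_gamma_density_eq C_def)
  qed
  finally show ?thesis .
qed

text \<open>If \<open>g x = x powr (a - 1) * gamma_series a (c * x)\<close>, which is unbounded, were log-convex, it would
  grow exponentially at some rate \<open>s\<close>; but \<open>g x * exp (- s * x)\<close> is a multiple of the noncentral gamma
  density with scale \<open>1 / s\<close>, hence integrable.\<close>

lemma not_log_convex_on_noncentral_gamma_density:
  assumes a: "0 < a" and b: "0 < b" and l: "0 < l"
  shows "\<not> log_convex_on {0<..} (noncentral_gamma_density a b l)"
proof
  assume conv: "log_convex_on {0<..} (noncentral_gamma_density a b l)"
  define c where "c = l / b"
  have c: "0 < c" using b l by (simp add: c_def)
  define g where "g x = x powr (a - 1) * gamma_series a (c * x)" for x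
  have gpos: "0 < g x" if "0 < x" for x using that a c by (simp add: g_def gamma_series_pos)
  define G where "G x = inverse (g x)" for x
  \<comment> \<open>The reciprocal of the density is log-concave; log-concave factors strip off its
    constant and exponential and leave \<open>1 / g\<close>.\<close>
  have "log_concave_on {0<..} (\<lambda>x. exp (- l) / b powr a * exp (- 1 / b * x) * inverse (noncentral_gamma_density a b l x))"
    using b conv by (intro log_concave_on_mult log_concave_on_exp log_concave_on_const)
      (auto simp: log_convex_on_iff_inverse)
  moreover have "exp (- l) / b powr a * exp (- 1 / b * x) * inverse (noncentral_gamma_density a b l x) = G x"
    if "x \<in> {0<..}" for x
  proof -
    have "noncentral_gamma_density a b l x = (exp (- l) / b powr a * exp (- 1 / b * x)) * g x"
      using a b that by (simp add: noncentral_gamma_density_eq g_def c_def)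
    moreover have "z * inverse (z * y) = inverse y" if "z \<noteq> 0" for z y :: real using that by simp
    moreover have "exp (- l) / b powr a * exp (- 1 / b * x) \<noteq> 0" using b by simp
    ultimately show ?thesis by (simp only: G_def)
  qed
  ultimately have G: "log_concave_on {0<..} G" by (subst (asm) log_concave_on_cong) auto
  \<comment> \<open>The linear term of the series raises the exponent from \<open>a - 1\<close> to
    \<open>a > 0\<close>; here positivity of \<open>l\<close> enters.\<close>
  have lower: "c / Gamma (a + 1) * x powr a \<le> g x" if x: "0 < x" for x
  proof -
    have "x powr (a - 1) * (c * x / Gamma (a + 1)) \<le> g x"
      unfolding g_def using gamma_series_ge_term[of a "c * x" 1] a c x by (intro mult_left_mono) auto
    moreover have "x powr a = x powr (a - 1) * x" using x powr_add[of x "a - 1" 1] by simp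
    ultimately show ?thesis by (simp add: mult_ac)
  qed
  have "filterlim (\<lambda>x. c / Gamma (a + 1) * x powr a) at_top at_top"
    using a c Gamma_real_pos[of "a + 1"] by real_asymp
  then have "eventually (\<lambda>x. g 1 < c / Gamma (a + 1) * x powr a \<and> 1 < x) at_top"
    by (intro eventually_conj eventually_gt_at_top) (simp add: filterlim_at_top_dense)
  from eventually_happens'[OF trivial_limit_at_top_linorder this]
  obtain x2 where "g 1 < c / Gamma (a + 1) * x2 powr a" and x2: "1 < x2" by blast
  with lower[of x2] have "g 1 < g x2" by simp
  then have "G x2 < G 1" using gpos[of 1] by (simp add: G_def)
  then obtain s where s: "0 < s" "\<And>x. x2 \<le> x \<Longrightarrow> G x \<le> G x2 * exp (- s * (x - x2))"
    using log_concave_on_exponential_decay[OF G, of 1 x2] x2 by auto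
  \<comment> \<open>With scale \<open>1 / s\<close> this noncentrality gives the series the same
    argument \<open>c * x\<close> as in \<open>g\<close>.\<close>
  define l' where "l' = c / s"
  define K where "K = exp (- l') / (1 / s) powr a"
  define D where "D = K * g x2 * exp (- s * x2)"
  have D: "0 < D" using s gpos x2 by (simp add: D_def K_def)
  have "D \<le> noncentral_gamma_density a (1 / s) l' x" if x: "x2 \<le> x" for x
  proof -
    have "0 < x" using x x2 by simp
    then have "noncentral_gamma_density a (1 / s) l' x = K * (g x * exp (- s * x))"
      using a s by (simp add: noncentral_gamma_density_eq g_def K_def l'_def mult_ac)
    moreover have "g x2 * exp (s * (x - x2)) \<le> g x"
    proof -
      have "inverse (g x) \<le> inverse (g x2 * exp (s * (x - x2)))"
        using s(2)[OF x] by (simp add: G_def exp_minus)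
      then show ?thesis using gpos[OF \<open>0 < x\<close>] by (rule inverse_le_imp_le)
    qed
    then have "K * (g x2 * exp (s * (x - x2)) * exp (- s * x)) \<le> K * (g x * exp (- s * x))"
      using s by (intro mult_left_mono mult_right_mono) (auto simp: K_def)
    moreover have "exp (s * (x - x2)) * exp (- s * x) = exp (- s * x2)"
      unfolding exp_add[symmetric] by (simp add: algebra_simps)
    ultimately show ?thesis by (simp only: D_def mult.assoc)
  qed
  \<comment> \<open>On an interval of length \<open>2 / D\<close> the lower bound \<open>D\<close>
    already accounts for mass 2, more than a probability density has.\<close>
  then have "(\<integral>\<^sup>+ x. ennreal D * indicator {x2..x2 + 2 / D} x \<partial>lborel)
      \<le> (\<integral>\<^sup>+ x. ennreal (noncentral_gamma_density a (1 / s) l' x) \<partial>lborel)"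
    by (intro nn_integral_mono) (auto simp: indicator_def ennreal_leI)
  also have "\<dots> = 1"
    using a s c by (intro nn_integral_noncentral_gamma_density) (auto simp: l'_def)
  finally show False
    using D by (simp add: nn_integral_cmult flip: ennreal_mult)
qed

section \<open>Criteria for the individual cases\<close>

lemma log_convex_on_central_gamma_sum_density:
  assumes a: "0 < a1" "0 < a2" "a1 + a2 \<le> 1" and b: "0 < b1" "0 < b2"
  shows "log_convex_on {0<..} (noncentral_gamma_sum_density a1 b1 0 a2 b2 0)"
proof -
  let ?p = "noncentral_gamma_sum_density a1 b1 0 a2 b2 0"
  define \<phi> where "\<phi> x y = indicator {0<..<x} y *
    (noncentral_gamma_density a1 b1 0 (x - y) * noncentral_gamma_density a2 b2 0 y)" for x y
  \<comment> \<open>Substituting \<open>y = x * u\<close> makes the range of integration independent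
    of \<open>x\<close>; the factor \<open>x\<close> is the Jacobian.\<close>
  define k where "k x u = x * \<phi> x (0 + x * u)" for x u
  define C where "C = 1 / (b1 powr a1 * Gamma a1) * (1 / (b2 powr a2 * Gamma a2))"
  define w where "w u = indicator {0<..<1} u * (C * ((1 - u) powr (a1 - 1) * u powr (a2 - 1)))" for u :: real
  define q where "q u = (1 - u) / b1 + u / b2" for u
  have C: "0 < C" using a b by (simp add: C_def Gamma_real_pos)
  have w: "0 \<le> w u" for u using C by (simp add: w_def)
  have k_eq: "k x u = w u * (x powr (a1 + a2 - 1) * exp (- (q u * x)))" if x: "0 < x" for x u
  proof (cases "u \<in> {0<..<1}")
    case True
    have e: "exp (- (x - x * u) / b1) * exp (- (x * u) / b2) = exp (- (q u * x))"
      unfolding exp_add[symmetric] by (simp add: q_def algebra_simps diff_divide_distrib)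
    have "x - x * u = x * (1 - u)" by (simp add: algebra_simps)
    then have p: "x * ((x - x * u) powr (a1 - 1) * (x * u) powr (a2 - 1))
      = (1 - u) powr (a1 - 1) * u powr (a2 - 1) * (x powr 1 * x powr (a1 - 1) * x powr (a2 - 1))"
      using x True by (simp add: powr_mult)
    have "x powr 1 * x powr (a1 - 1) * x powr (a2 - 1) = x powr (a1 + a2 - 1)"
      unfolding powr_add[symmetric] by (simp add: algebra_simps)
    with p have p: "x * ((x - x * u) powr (a1 - 1) * (x * u) powr (a2 - 1))
      = (1 - u) powr (a1 - 1) * u powr (a2 - 1) * x powr (a1 + a2 - 1)" by simp
    have "k x u = C * (x * ((x - x * u) powr (a1 - 1) * (x * u) powr (a2 - 1)))
        * (exp (- (x - x * u) / b1) * exp (- (x * u) / b2))"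
      using True x by (simp add: k_def \<phi>_def C_def noncentral_gamma_density_central)
    then show ?thesis unfolding e p using True by (simp add: w_def)
  next
    case False
    then have "x * u \<notin> {0<..<x}" using x by (auto simp: zero_less_mult_iff)
    then show ?thesis using False by (simp add: k_def \<phi>_def w_def)
  qed
  have p_eq: "?p x = (LBINT u. k x u)" if x: "0 < x" for x
    unfolding noncentral_gamma_sum_density_def set_lebesgue_integral_def k_def
    using lborel_integral_real_affine[of x "\<phi> x" 0] x by (simp add: \<phi>_def)
  have "log_convex_on {0<..} (\<lambda>x. LBINT u. k x u)"
  proof (rule log_convex_on_integral)
    fix x :: real assume x: "x \<in> {0<..}"
    have "integrable lborel (\<phi> x)"
      using noncentral_gamma_sum_integrable[of a1 b1 0 a2 b2 0 x] a b x
      by (simp add: \<phi>_def[abs_def] set_integrable_def)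
    then show "integrable lborel (k x)"
      using x unfolding k_def[abs_def] by (intro integrable_mult_right lborel_integrable_real_affine) auto
    show "0 < (LBINT u. k x u)"
      using noncentral_gamma_sum_density_pos[of a1 b1 0 a2 b2 0 x] a b x by (simp add: p_eq)
    show "0 \<le> k x u" for u using x w by (simp add: k_eq)
    fix y t u :: real assume y: "y \<in> {0<..}" and t: "t \<in> {0..1}"
    have xy: "0 < x" "0 < y" using x y by auto
    have young: "x powr t * y powr (1 - t) \<le> t * x + (1 - t) * y"
      using xy t by (intro Youngs_inequality_0) auto
    have z: "0 < t * x + (1 - t) * y" using young xy by (auto intro: less_le_trans[rotated])
    \<comment> \<open>The exponent is at most 0, so it reverses AM-GM. This is where
      \<open>a1 + a2 \<le> 1\<close> is used.\<close>
    have "(t * x + (1 - t) * y) powr (a1 + a2 - 1) \<le> (x powr t * y powr (1 - t)) powr (a1 + a2 - 1)"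
      using young a xy by (intro powr_mono2') auto
    also have "\<dots> = (x powr (a1 + a2 - 1)) powr t * (y powr (a1 + a2 - 1)) powr (1 - t)"
      by (simp add: powr_mult powr_powr mult.commute)
    finally have 1: "(t * x + (1 - t) * y) powr (a1 + a2 - 1)
      \<le> (x powr (a1 + a2 - 1)) powr t * (y powr (a1 + a2 - 1)) powr (1 - t)" .
    have 2: "exp (- (q u * (t * x + (1 - t) * y))) = exp (- (q u * x)) powr t * exp (- (q u * y)) powr (1 - t)"
      by (simp add: powr_def flip: exp_add) (simp add: algebra_simps)
    have 3: "w u = w u powr t * w u powr (1 - t)" using w[of u] by (cases "w u = 0") (auto simp flip: powr_add)
    have "k (t * x + (1 - t) * y) u \<le> w u * ((x powr (a1 + a2 - 1)) powr t * (y powr (a1 + a2 - 1)) powr (1 - t)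
      * exp (- (q u * (t * x + (1 - t) * y))))"
      using 1 w z by (simp add: k_eq mult_left_mono mult_right_mono)
    also have "\<dots> = k x u powr t * k y u powr (1 - t)"
      unfolding 2 k_eq[OF xy(1)] k_eq[OF xy(2)]
      by (subst 3) (simp add: powr_mult mult_ac)
    finally show "k (t * x + (1 - t) * y) u \<le> k x u powr t * k y u powr (1 - t)" .
  qed (simp add: is_interval_convex_1)
  then show ?thesis using log_convex_on_cong[of "{0<..}" ?p] p_eq by simp
qed

lemma log_convex_on_central_gamma_sum_density_iff:
  assumes "0 < a1" "0 < a2" "0 < b1" "0 < b2"
  shows "log_convex_on {0<..} (noncentral_gamma_sum_density a1 b1 0 a2 b2 0) \<longleftrightarrow> a1 + a2 \<le> 1"
proof
  show "a1 + a2 \<le> 1" if conv: "log_convex_on {0<..} (noncentral_gamma_sum_density a1 b1 0 a2 b2 0)"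
  proof (rule ccontr)
    assume gt: "\<not> a1 + a2 \<le> 1"
    \<comment> \<open>For central summands the upper bound evaluates the series at 0, so its
      constant does not depend on \<open>x\<close>.\<close>
    define C where "C = 1 / b1 powr a1 * gamma_series a1 0 * (1 / b2 powr a2 * gamma_series a2 0) * Beta a1 a2"
    have "\<not> log_convex_on {0<..} (noncentral_gamma_sum_density a1 b1 0 a2 b2 0)"
    proof (rule not_log_convex_on_if_le_powr)
      show "0 < a1 + a2 - 1" using gt by simp
      show "noncentral_gamma_sum_density a1 b1 0 a2 b2 0 x \<le> C * x powr (a1 + a2 - 1)" if "0 < x" for x
        using noncentral_gamma_sum_density_upper[of a1 b1 0 a2 b2 0 x] assms that by (simp add: C_def mult_ac)
    qed
    then show False using conv by simp
  qed
qed (use assms in \<open>simp add: log_convex_on_central_gamma_sum_density\<close>)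

lemma log_concave_on_noncentral_gamma_density_iff:
  assumes a: "0 < a" and b: "0 < b" and l: "0 \<le> l"
  shows "log_concave_on {0<..} (noncentral_gamma_density a b l) \<longleftrightarrow> 1 \<le> a"
proof
  show "1 \<le> a" if conc: "log_concave_on {0<..} (noncentral_gamma_density a b l)"
  proof (rule ccontr)
    assume lt: "\<not> 1 \<le> a"
    have "\<not> log_concave_on {0<..} (noncentral_gamma_density a b l)"
    proof (rule not_log_concave_on_if_ge_powr)
      show "a - 1 < 0" using lt by simp
      \<comment> \<open>The obstruction looks at \<open>(0, 2)\<close>, so the exponential is
        estimated by its value at 2.\<close>
      show "0 < exp (- l) / b powr a * exp (- 2 / b) / Gamma a" using a b by (simp add: Gamma_real_pos)
      show "exp (- l) / b powr a * exp (- 2 / b) / Gamma a * x powr (a - 1) \<le> noncentral_gamma_density a b l x"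
        if "0 < x" "x < 2" for x
        using noncentral_gamma_density_lower[of a b l x 2] assms that by simp
    qed
    then show False using conc by simp
  qed
qed (use b l in \<open>simp add: log_concave_on_noncentral_gamma_density\<close>)

lemma log_concave_on_central_gamma_sum_density_iff:
  assumes a: "0 < a" and b: "0 < b1" "0 < b2" "b1 \<noteq> b2"
  shows "log_concave_on {0<..} (noncentral_gamma_sum_density a b1 0 a b2 0) \<longleftrightarrow> 1 \<le> a"
proof
  show "1 \<le> a" if conc: "log_concave_on {0<..} (noncentral_gamma_sum_density a b1 0 a b2 0)"
  proof (rule ccontr)
    assume "\<not> 1 \<le> a"
    \<comment> \<open>The obstruction expects the larger scale in first place; equal shapes allow
      the summands to be swapped.\<close>
    moreover have "noncentral_gamma_sum_density a b1 0 a b2 0 = noncentral_gamma_sum_density a b2 0 a b1 0"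
      by (rule ext) (rule noncentral_gamma_sum_density_commute)
    ultimately show False
      using conc a b not_log_concave_on_central_gamma_sum_density[of a b1 b2]
        not_log_concave_on_central_gamma_sum_density[of a b2 b1] by (cases b1 b2 rule: linorder_cases) auto
  qed
qed (use b in \<open>simp add: log_concave_on_noncentral_gamma_sum_density\<close>)

theorem theorem2p4:
  fixes M :: "'a measure" and G1 G2 :: "'a \<Rightarrow> real"
    and a1 a2 b1 b2 l1 l2 :: real and p :: "real \<Rightarrow> real"
  assumes "prob_space M"
    and "0 < a1" and "0 < a2" and "0 < b1" and "0 < b2" and "0 \<le> l1" and "0 \<le> l2"
    and "distributed M lborel G1 (\<lambda>x. ennreal (noncentral_gamma_density a1 b1 l1 x))"
    and "distributed M lborel G2 (\<lambda>x. ennreal (noncentral_gamma_density a2 b2 l2 x))"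
    and "prob_space.indep_var M borel G1 borel G2"
    and "distributed M lborel (\<lambda>\<omega>. G1 \<omega> + G2 \<omega>) (\<lambda>x. ennreal (p x))"
    and "\<And>x. 0 < x \<Longrightarrow> p x = noncentral_gamma_sum_density a1 b1 l1 a2 b2 l2 x"
  shows "(l1 = 0 \<and> l2 = 0 \<longrightarrow> (log_convex_on {0<..} p \<longleftrightarrow> a1 + a2 \<le> 1))
    \<and> (1 \<le> a1 \<and> 1 \<le> a2 \<longrightarrow> log_concave_on {0<..} p)
    \<and> (b1 = b2 \<longrightarrow>
         (log_concave_on {0<..} p \<longleftrightarrow> 1 \<le> a1 + a2) \<and>
         (log_convex_on {0<..} p \<longleftrightarrow> l1 = 0 \<and> l2 = 0 \<and> a1 + a2 \<le> 1))
    \<and> (l1 = 0 \<and> l2 = 0 \<and> a1 = a2 \<and> b1 \<noteq> b2 \<longrightarrow>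
         (log_concave_on {0<..} p \<longleftrightarrow> 1 \<le> a1))"
proof -
  let ?p = "noncentral_gamma_sum_density a1 b1 l1 a2 b2 l2"
  \<comment> \<open>\<open>p\<close> is prescribed only on the positive half-line, and both notions
    depend only on values there.\<close>
  have convex_iff: "log_convex_on {0<..} p \<longleftrightarrow> log_convex_on {0<..} ?p"
    and concave_iff: "log_concave_on {0<..} p \<longleftrightarrow> log_concave_on {0<..} ?p"
    by (rule log_convex_on_cong log_concave_on_cong; simp add: assms(12))+
  have same_scale: "log_concave_on {0<..} ?p \<longleftrightarrow> 1 \<le> a1 + a2"
      "log_convex_on {0<..} ?p \<longleftrightarrow> l1 = 0 \<and> l2 = 0 \<and> a1 + a2 \<le> 1" if b: "b1 = b2"
  proof -
    have eq: "?p x = noncentral_gamma_density (a1 + a2) b1 (l1 + l2) x" if "x \<in> {0<..}" for x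
      using noncentral_gamma_sum_density_same_scale[of a1 a2 b1 l1 l2 x] assms(2-7) b that by simp
    show "log_concave_on {0<..} ?p \<longleftrightarrow> 1 \<le> a1 + a2"
      using log_concave_on_noncentral_gamma_density_iff[of "a1 + a2" b1 "l1 + l2"]
        log_concave_on_cong[OF eq, of "{0<..}"] assms(2-7) by simp
    show "log_convex_on {0<..} ?p \<longleftrightarrow> l1 = 0 \<and> l2 = 0 \<and> a1 + a2 \<le> 1"
    proof (cases "l1 = 0 \<and> l2 = 0")
      case True
      then show ?thesis using log_convex_on_central_gamma_sum_density_iff[of a1 a2 b1 b2] assms(2-7) by simp
    next
      case False
      then have "0 < l1 + l2" using assms(6,7) by auto
      then show ?thesis
        using not_log_convex_on_noncentral_gamma_density[of "a1 + a2" b1 "l1 + l2"]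
          log_convex_on_cong[OF eq, of "{0<..}"] assms(2-7) False by simp
    qed
  qed
  show ?thesis unfolding convex_iff concave_iff
    using same_scale log_convex_on_central_gamma_sum_density_iff[OF assms(2-5)]
      log_concave_on_noncentral_gamma_sum_density[of a1 b1 l1 a2 b2 l2]
      log_concave_on_central_gamma_sum_density_iff[of a1 b1 b2] assms(2-7)
    by auto
qed

end
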